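(* For every $0<\kappa<1/4$ there is a constant $C$, depending only on $\kappa$, such that the following holds for every set $X$ and every set $F$ of functions from $X$ to $[0,1]$. (i) If $\mathrm{fat}_F((1/4-\kappa)\epsilon)$ is finite for all $\epsilon>0$, then for all $0<\epsilon,\delta\le 1/2$, $$m_{\mathrm{GC},F}(\epsilon,\delta)\ \le\ \frac{C}{\epsilon^2}\left(\mathrm{fat}_F((1/4-\kappa)\epsilon)\,\log^2\frac1\epsilon+\log\frac1\delta\right).$$ (ii) If $\mathrm{fatV}_F((1/4-\kappa)\epsilon)$ is finite for all $\epsilon>0$, then for all $0<\epsilon,\delta\le1/2$, $$m_{\mathrm{GC},F}(\epsilon,\delta)\ \le\ \frac{C}{\epsilon^2}\left(\frac1\epsilon\,\mathrm{fatV}_F((1/4-\kappa)\epsilon)\,\log\frac1\epsilon+\log\frac1\delta\right).$$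
   Context: For $\epsilon,\delta>0$ and a set $F$ of functions from $X$ to $[0,1]$, $m_{\mathrm{GC},F}(\epsilon,\delta)$ is the least positive integer $n$ such that for all $m\ge n$ and all probability distributions $D$ on $X$, $$D^m\Big\{(x_1,\dots,x_m):\exists f\in F,\ \Big|\frac1m\sum_{i=1}^m f(x_i)-\int_X f\,dD\Big|>\epsilon\Big\}\le\delta,$$ and $m_{\mathrm{GC},F}(\epsilon,\delta)=\infty$ if no such $n$ exists. $F$ $\gamma$-fatly shatters a sequence $(x_1,r_1),\dots,(x_d,r_d)$ in $X\times[0,1]$ if for every $b\in\{0,1\}^d$ there is $f\in F$ with, for all $j$, $f(x_j)\ge r_j+\gamma$ if $b_j=1$ and $f(x_j)\le r_j-\gamma$ if $b_j=0$. $\mathrm{fat}_F(\gamma)$ is the largest length of such a sequence ($\infty$ if unbounded, $0$ if there is none of positive length). $\mathrm{fatV}_F(\gamma)$ is defined in the same way but requiring all the thresholds to be equal, $r_1=\dots=r_d=r$ for a single $r\in[0,1]$. Convention: issues of measurability are ignored; the reader may assume that $X$ is countable with all subsets measurable. *)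

theory Defs
  imports "HOL-Probability.Probability"
begin

text \<open>
  Function classes are sets \<^term>\<open>F :: ('a \<Rightarrow> real) set\<close> whose members map \<^term>\<open>X :: 'a set\<close>
  into the unit interval; their values outside \<^term>\<open>X\<close> are irrelevant.  Measurability is dealt
  with by taking \<^term>\<open>X\<close> countable and all its subsets measurable.
\<close>

definition GC_ok ::
  "'a set \<Rightarrow> ('a \<Rightarrow> real) set \<Rightarrow> real \<Rightarrow> real \<Rightarrow> nat \<Rightarrow> bool" where
  "GC_ok X F \<epsilon> \<delta> m \<longleftrightarrow>
     (\<forall>D. prob_space D \<and> sets D = Pow X \<longrightarrow>
        measure (PiM {..<m} (\<lambda>_. D))
          {x \<in> space (PiM {..<m} (\<lambda>_. D)).
             \<exists>f\<in>F. \<bar>(1 / real m) * (\<Sum>i<m. f (x i)) - (\<integral>y. f y \<partial>D)\<bar> > \<epsilon>} \<le> \<delta>)"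

text \<open>In \<^typ>\<open>enat\<close>, the infimum of the empty set is \<open>\<infinity>\<close>, its supremum is \<open>0\<close>, and the
  supremum of an unbounded set is \<open>\<infinity>\<close>.\<close>

definition m_GC :: "'a set \<Rightarrow> ('a \<Rightarrow> real) set \<Rightarrow> real \<Rightarrow> real \<Rightarrow> enat" where
  "m_GC X F \<epsilon> \<delta> = Inf {enat n | n. 1 \<le> n \<and> (\<forall>m\<ge>n. GC_ok X F \<epsilon> \<delta> m)}"

definition fatly_shatters :: "('a \<Rightarrow> real) set \<Rightarrow> real \<Rightarrow> ('a \<times> real) list \<Rightarrow> bool" where
  "fatly_shatters F \<gamma> ps \<longleftrightarrow>
     (\<forall>b :: bool list. length b = length ps \<longrightarrow>
        (\<exists>f\<in>F. \<forall>j<length ps.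
           (b ! j \<longrightarrow> f (fst (ps ! j)) \<ge> snd (ps ! j) + \<gamma>) \<and>
           (\<not> b ! j \<longrightarrow> f (fst (ps ! j)) \<le> snd (ps ! j) - \<gamma>)))"

definition fat :: "'a set \<Rightarrow> ('a \<Rightarrow> real) set \<Rightarrow> real \<Rightarrow> enat" where
  "fat X F \<gamma> = Sup {enat (length ps) | ps. set ps \<subseteq> X \<times> {0..1} \<and> fatly_shatters F \<gamma> ps}"

definition fatV :: "'a set \<Rightarrow> ('a \<Rightarrow> real) set \<Rightarrow> real \<Rightarrow> enat" where
  "fatV X F \<gamma> = Sup {enat (length ps) | ps. set ps \<subseteq> X \<times> {0..1} \<and>
     (\<exists>r\<in>{0..1}. \<forall>p\<in>set ps. snd p = r) \<and> fatly_shatters F \<gamma> ps}"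

definition fat_bound :: "real \<Rightarrow> real \<Rightarrow> 'a set \<Rightarrow> ('a \<Rightarrow> real) set \<Rightarrow> bool" where
  "fat_bound \<kappa> C X F \<longleftrightarrow>
     ((\<forall>\<epsilon>>0. fat X F ((1/4 - \<kappa>) * \<epsilon>) < \<infinity>) \<longrightarrow>
      (\<forall>\<epsilon> \<delta>. 0 < \<epsilon> \<and> \<epsilon> \<le> 1/2 \<and> 0 < \<delta> \<and> \<delta> \<le> 1/2 \<longrightarrow>
         ereal_of_enat (m_GC X F \<epsilon> \<delta>) \<le>
           ereal (C / \<epsilon>\<^sup>2) *
           (ereal_of_enat (fat X F ((1/4 - \<kappa>) * \<epsilon>)) * ereal ((ln (1 / \<epsilon>))\<^sup>2) +
            ereal (ln (1 / \<delta>)))))"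

definition fatV_bound :: "real \<Rightarrow> real \<Rightarrow> 'a set \<Rightarrow> ('a \<Rightarrow> real) set \<Rightarrow> bool" where
  "fatV_bound \<kappa> C X F \<longleftrightarrow>
     ((\<forall>\<epsilon>>0. fatV X F ((1/4 - \<kappa>) * \<epsilon>) < \<infinity>) \<longrightarrow>
      (\<forall>\<epsilon> \<delta>. 0 < \<epsilon> \<and> \<epsilon> \<le> 1/2 \<and> 0 < \<delta> \<and> \<delta> \<le> 1/2 \<longrightarrow>
         ereal_of_enat (m_GC X F \<epsilon> \<delta>) \<le>
           ereal (C / \<epsilon>\<^sup>2) *
           (ereal (1 / \<epsilon>) * ereal_of_enat (fatV X F ((1/4 - \<kappa>) * \<epsilon>)) * ereal (ln (1 / \<epsilon>)) +
            ereal (ln (1 / \<delta>)))))"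

text \<open>\<open>valid_const TYPE('a) \<kappa> C\<close>: the constant \<^term>\<open>C\<close> works for all domains \<^term>\<open>X\<close> that are
  sets of elements of type \<^typ>\<open>'a\<close>.  A constant depending on \<^term>\<open>\<kappa>\<close> only must not depend on
  \<^typ>\<open>'a\<close> either, but a quantifier \<open>\<exists>C\<close> in front of a statement about an arbitrary \<^typ>\<open>'a\<close> would
  permit that.  Uniformity over all types is therefore expressed by asserting that some \<^term>\<open>C\<close>
  is valid for \<^typ>\<open>nat\<close> and that every such \<^term>\<open>C\<close> is valid for every \<^typ>\<open>'a\<close>.\<close>

definition valid_const :: "'a itself \<Rightarrow> real \<Rightarrow> real \<Rightarrow> bool" where
  "valid_const _ \<kappa> C \<longleftrightarrow>
     (\<forall>(X :: 'a set) F. countable X \<and> F \<subseteq> X \<rightarrow> {0..1} \<longrightarrow>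
        fat_bound \<kappa> C X F \<and> fatV_bound \<kappa> C X F)"

end

(*
  The engine is a packing bound in the spirit of Mendelson and Vershynin.  Let A be a set of N
  functions with pairwise average distance at least rho on a sample.  Some sample point has
  E |Z - Z'| >= rho (1 - 1/N), where Z and Z' are the values there of two independent random members
  of A.  If no gap of width s, slightly less than rho, splits A into parts of sizes p N and q N with
  p^a + q^a >= 1, then the tails of Z beyond distance s from its median decay so fast that
  E |Z - Z'| is barely above s, the largest value possible inside a window of width 2 s; for a small
  exponent a = 1/k depending only on kappa this is a contradiction.  Splitting recursively, A shatters
  at least N^a sets of sample points with thresholds on a grid, with margin about rho / 2.  These
  sets have at most d = fat elements, and among L points there are at most v^(-d) exp (v L) such
  sets for every weight 0 < v <= 1.  With v of order epsilon^3 the factor exp (v L) is absorbed by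
  the deviation bound, so no logarithm of the sample size appears.

  Symmetrization with a ghost sample, random swaps and a union bound over a rho-net of the double
  sample with rho slightly less than epsilon / 2 then give a sample complexity of order
  (d log (1/epsilon) + log (1/delta)) / epsilon^2.  This is at least as good as (i), and it implies
  (ii) because rounding thresholds to a grid of width of order epsilon bounds fat by a multiple of
  fatV / epsilon at a slightly smaller scale.
*)

theory Submission
  imports Defs
begin

section \<open>Shattering with a margin\<close>

text \<open>A pair \<open>(x, r)\<close> demands values below \<open>r\<close> or above \<open>r + s\<close>, i.e. the threshold
  \<open>r + s / 2\<close> with margin \<open>s / 2\<close> in the usual normalisation.\<close>

definition shat :: "real \<Rightarrow> ('i \<Rightarrow> real) set \<Rightarrow> ('i \<times> real) set \<Rightarrow> bool" where
  "shat s A P \<longleftrightarrow>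
     (\<forall>Q\<subseteq>P. \<exists>f\<in>A. (\<forall>(x, r)\<in>Q. r + s \<le> f x) \<and> (\<forall>(x, r)\<in>P - Q. f x \<le> r))"

text \<open>All shattered sets are recorded, not just the largest size, because their number is
  superadditive when the class is split by a gap at one point.\<close>

definition shats :: "real \<Rightarrow> ('i \<Rightarrow> real) set \<Rightarrow> ('i \<times> real) set \<Rightarrow> ('i \<times> real) set set" where
  "shats s A U = {P. P \<subseteq> U \<and> shat s A P}"

lemma finite_shats: "finite U \<Longrightarrow> finite (shats s A U)"
  unfolding shats_def by (rule finite_subset[of _ "Pow U"]) auto

lemma shat_mono: "shat s A P \<Longrightarrow> A \<subseteq> B \<Longrightarrow> shat s B P"
  unfolding shat_def by (meson subsetD)

lemma empty_in_shats: "A \<noteq> {} \<Longrightarrow> {} \<in> shats s A U"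
  by (auto simp: shats_def shat_def)

lemma card_shats_ge_1:
  assumes "finite U" "A \<noteq> {}"
  shows "1 \<le> card (shats s A U)"
proof -
  have "card (shats s A U) > 0"
    using finite_shats[OF assms(1), of s A] empty_in_shats[OF assms(2), of s U]
    by (subst card_gt_0_iff) auto
  then show ?thesis by simp
qed

text \<open>A set shattered by exactly one of the two halves is counted once, as itself. A set
  \<open>P\<close> shattered by both halves is counted twice, as \<open>P\<close> and as
  \<open>insert (x, r) P\<close>. The inserted sets are new: all of the lower half lies below the
  gap at \<open>x\<close> and all of the upper half above it, so neither half shatters a set
  containing \<open>(x, r)\<close>.\<close>

lemma card_shats_split:
  assumes U: "finite U" "(x, r) \<in> U" and s: "s > 0"
  shows "card (shats s {f\<in>A. f x \<le> r} U) + card (shats s {f\<in>A. r + s \<le> f x} U)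
           \<le> card (shats s A U)"
proof -
  let ?L = "{f\<in>A. f x \<le> r}" and ?H = "{f\<in>A. r + s \<le> f x}"
  let ?l = "shats s ?L U" and ?h = "shats s ?H U" and ?i = "insert (x, r)"
  have nL: "(x, r) \<notin> P" if "P \<in> ?l" for P
  proof
    assume "(x, r) \<in> P"
    moreover have "shat s ?L P" using that by (simp add: shats_def)
    then obtain f where "f \<in> ?L" "\<forall>(x, r)\<in>P. r + s \<le> f x"
      unfolding shat_def by blast
    ultimately show False using s by fastforce
  qed
  have nH: "(x, r) \<notin> P" if "P \<in> ?h" for P
  proof
    assume "(x, r) \<in> P"
    moreover have "shat s ?H P" using that by (simp add: shats_def)
    then have "\<exists>f\<in>?H. \<forall>(x, r)\<in>P. f x \<le> r"
      unfolding shat_def by (elim allE[of _ "{}"]) auto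
    then obtain f where "f \<in> ?H" "\<forall>(x, r)\<in>P. f x \<le> r" by blast
    ultimately show False using s by fastforce
  qed
  \<comment> \<open>A labelling with \<open>(x, r)\<close> on the upper side is realised inside
    \<open>?H\<close>, every other labelling inside \<open>?L\<close>.\<close>
  have ins: "?i P \<in> shats s A U" if l: "P \<in> ?l" and h: "P \<in> ?h" for P
  proof -
    have "\<exists>f\<in>A. (\<forall>(x, r)\<in>Q. r + s \<le> f x) \<and> (\<forall>(x, r)\<in>?i P - Q. f x \<le> r)"
      if Q: "Q \<subseteq> ?i P" for Q
    proof (cases "(x, r) \<in> Q")
      case True
      have "Q - {(x, r)} \<subseteq> P" using Q by auto
      then obtain f where "f \<in> ?H" "\<forall>(x, r)\<in>Q - {(x, r)}. r + s \<le> f x"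
          "\<forall>(x, r)\<in>P - (Q - {(x, r)}). f x \<le> r"
        using h unfolding shats_def shat_def by blast
      then show ?thesis using True nH[OF h] by (intro bexI[of _ f]) auto
    next
      case False
      then have "Q \<subseteq> P" using Q by auto
      then obtain f where "f \<in> ?L" "\<forall>(x, r)\<in>Q. r + s \<le> f x" "\<forall>(x, r)\<in>P - Q. f x \<le> r"
        using l unfolding shats_def shat_def by blast
      then show ?thesis by (intro bexI[of _ f]) auto
    qed
    then show ?thesis using l U(2) by (auto simp: shats_def shat_def)
  qed
  have fin: "finite ?l" "finite ?h" "finite (shats s A U)"
    using finite_shats[OF U(1)] by auto
  have inj: "inj_on ?i (?l \<inter> ?h)"
  proof (rule inj_onI)
    fix P Q assume "P \<in> ?l \<inter> ?h" "Q \<in> ?l \<inter> ?h" "?i P = ?i Q"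
    then show "P = Q" using nL[of P] nL[of Q] by (simp add: insert_ident)
  qed
  have "card ?l + card ?h = card (?l \<union> ?h) + card (?l \<inter> ?h)"
    by (rule card_Un_Int) (use fin in auto)
  also have "card (?l \<inter> ?h) = card (?i ` (?l \<inter> ?h))"
    by (rule card_image[symmetric, OF inj])
  also have "card (?l \<union> ?h) + \<dots> = card ((?l \<union> ?h) \<union> ?i ` (?l \<inter> ?h))"
    by (rule card_Un_disjoint[symmetric]) (use fin nL nH in auto)
  also have "\<dots> \<le> card (shats s A U)"
  proof (rule card_mono[OF fin(3)])
    show "?l \<union> ?h \<union> ?i ` (?l \<inter> ?h) \<subseteq> shats s A U"
      using ins by (auto simp: shats_def intro: shat_mono)
  qed
  finally show ?thesis .
qed

section \<open>Counting sets of bounded size\<close>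

lemma sum_power_card_Pow:
  fixes v :: real
  assumes "finite U"
  shows "(\<Sum>P\<in>Pow U. v ^ card P) = (1 + v) ^ card U"
proof -
  have "(1 + v) ^ card U = (\<Prod>i\<in>U. v + 1)" by (simp add: add.commute)
  also have "\<dots> = (\<Sum>P\<in>Pow U. (\<Prod>i\<in>P. v) * (\<Prod>i\<in>U - P. 1))"
    by (rule prod_add[OF assms])
  finally show ?thesis by simp
qed

text \<open>A generating function argument: give every set \<open>P\<close> the weight
  \<open>v ^ card P\<close>. Members of \<open>S\<close> weigh at least \<open>v ^ d\<close>, and
  all subsets of \<open>U\<close> together weigh \<open>(1 + v) ^ card U\<close>. The free parameter
  \<open>v\<close> trades the factor exponential in \<open>card U\<close> against the power with
  exponent \<open>d\<close>.\<close>

lemma card_bounded_subsets_le: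
  fixes v :: real
  assumes U: "finite U" and S: "S \<subseteq> Pow U" "\<And>P. P \<in> S \<Longrightarrow> card P \<le> d"
    and v: "0 < v" "v \<le> 1"
  shows "real (card S) \<le> exp (v * card U) / v ^ d"
proof -
  have "real (card S) * v ^ d = (\<Sum>P\<in>S. v ^ d)" by simp
  also have "\<dots> \<le> (\<Sum>P\<in>S. v ^ card P)"
    by (intro sum_mono power_decreasing) (use S v in auto)
  also have "\<dots> \<le> (\<Sum>P\<in>Pow U. v ^ card P)"
    by (rule sum_mono2) (use U S v in auto)
  also have "\<dots> = (1 + v) ^ card U" by (rule sum_power_card_Pow[OF U])
  also have "\<dots> \<le> exp v ^ card U" by (rule power_mono) (use v in auto)
  also have "\<dots> = exp (v * card U)" by (simp add: exp_of_nat_mult[symmetric] mult.commute)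
  finally show ?thesis using v by (simp add: field_simps)
qed

section \<open>Widely spread values have a balanced gap\<close>

text \<open>The extreme case has half of the values at each end of the window. After shifting to
  \<open>[0, L]\<close>, each distance is dominated by a bilinear expression in the two values, so
  the double sum is bounded by a quadratic in the total \<open>M\<close> alone, and that quadratic
  is largest at \<open>M = L N / 2\<close>.\<close>

lemma sum_abs_diff_window_le:
  fixes w :: "'b \<Rightarrow> real"
  assumes "finite A" and w: "\<And>a. a \<in> A \<Longrightarrow> l \<le> w a \<and> w a \<le> l + L" and L: "L > 0"
  shows "(\<Sum>a\<in>A. \<Sum>b\<in>A. \<bar>w a - w b\<bar>) \<le> L / 2 * (card A)\<^sup>2"
proof -
  define u where "u a = w a - l" for a
  define M where "M = (\<Sum>a\<in>A. u a)"
  let ?N = "real (card A)"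
  have le: "\<bar>w a - w b\<bar> \<le> u a + u b - 2 * u a * u b / L" if "a \<in> A" "b \<in> A" for a b
  proof -
    \<comment> \<open>Replacing \<open>y\<close> by its upper bound \<open>L\<close> in the product
      turns the right-hand side into \<open>y - x\<close>.\<close>
    have *: "y - x \<le> x + y - 2 * x * y / L" if "0 \<le> x" "y \<le> L" for x y :: real
    proof -
      have "2 * x * y / L \<le> 2 * x * L / L"
        by (intro divide_right_mono mult_left_mono) (use that L in auto)
      then show ?thesis using L by simp
    qed
    have "u a \<ge> 0" "u b \<ge> 0" "u a \<le> L" "u b \<le> L"
      using w[OF that(1)] w[OF that(2)] by (auto simp: u_def)
    then have "u b - u a \<le> u a + u b - 2 * u a * u b / L" "u a - u b \<le> u a + u b - 2 * u a * u b / L"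
      using *[of "u a" "u b"] *[of "u b" "u a"] by (simp_all add: ac_simps)
    moreover have "\<bar>w a - w b\<bar> = max (u b - u a) (u a - u b)" by (simp add: u_def)
    ultimately show ?thesis by simp
  qed
  have "(\<Sum>a\<in>A. \<Sum>b\<in>A. \<bar>w a - w b\<bar>) \<le> (\<Sum>a\<in>A. \<Sum>b\<in>A. u a + u b - 2 * u a * u b / L)"
    by (intro sum_mono le)
  also have "\<dots> = 2 * ?N * M - 2 * M\<^sup>2 / L"
  proof -
    have "(\<Sum>a\<in>A. \<Sum>b\<in>A. u a + u b - 2 * u a * u b / L)
            = (\<Sum>a\<in>A. ?N * u a + M - 2 * u a * M / L)"
      by (simp add: sum.distrib sum_subtractf M_def sum_distrib_left sum_divide_distrib)
    also have "\<dots> = 2 * ?N * M - 2 * M\<^sup>2 / L"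
      by (simp add: sum.distrib sum_subtractf sum_distrib_left[symmetric]
          sum_distrib_right[symmetric] sum_divide_distrib[symmetric] flip: M_def)
        (simp add: power2_eq_square)
    finally show ?thesis .
  qed
  also have "\<dots> \<le> L / 2 * ?N\<^sup>2"
  proof -
    have "0 \<le> 2 / L * (M - L / 2 * ?N)\<^sup>2" using L by simp
    also have "\<dots> = L / 2 * ?N\<^sup>2 - (2 * ?N * M - 2 * M\<^sup>2 / L)"
      using L by (simp add: power2_eq_square field_simps)
    finally show ?thesis by simp
  qed
  finally show ?thesis by simp
qed

text \<open>Cut the excess over \<open>c\<close> into layers of height \<open>s\<close>. Each layer
  costs at most \<open>s\<close> per element reaching its bottom, and these numbers halve from layer
  to layer, so the geometric series gives the factor 2. The induction is on the number
  \<open>n\<close> of layers.\<close>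

lemma sum_excess_le_tail:
  fixes z :: "'b \<Rightarrow> real"
  assumes A: "finite A" and s: "s \<ge> 0"
    and halve: "\<And>t. t \<ge> c \<Longrightarrow> 2 * card {a\<in>A. z a \<ge> t + s} \<le> card {a\<in>A. z a \<ge> t}"
    and bound: "\<And>a. a \<in> A \<Longrightarrow> z a \<le> c + real n * s"
  shows "(\<Sum>a\<in>A. max 0 (z a - c)) \<le> 2 * s * card {a\<in>A. z a \<ge> c}"
  using halve bound
proof (induction n arbitrary: c)
  case 0
  then have "(\<Sum>a\<in>A. max 0 (z a - c)) = 0" by (intro sum.neutral) auto
  then show ?case using s by simp
next
  case (Suc n)
  have IH: "(\<Sum>a\<in>A. max 0 (z a - (c + s))) \<le> 2 * s * card {a\<in>A. z a \<ge> c + s}"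
  proof (rule Suc.IH)
    show "2 * card {a\<in>A. z a \<ge> t + s} \<le> card {a\<in>A. z a \<ge> t}" if "t \<ge> c + s" for t
      using Suc.prems(1)[of t] that s by simp
    show "z a \<le> c + s + real n * s" if "a \<in> A" for a
      using Suc.prems(2)[OF that] by (simp add: algebra_simps)
  qed
  have "(\<Sum>a\<in>A. max 0 (z a - c))
          \<le> (\<Sum>a\<in>A. (if z a \<ge> c then s else 0) + max 0 (z a - (c + s)))"
    by (intro sum_mono) (use s in auto)
  also have "\<dots> = s * card {a\<in>A. z a \<ge> c} + (\<Sum>a\<in>A. max 0 (z a - (c + s)))"
    using A by (simp add: sum.distrib sum.If_cases Int_def)
  also have "\<dots> \<le> s * card {a\<in>A. z a \<ge> c} + s * (2 * card {a\<in>A. z a \<ge> c + s})"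
    using IH by simp
  also have "\<dots> \<le> s * card {a\<in>A. z a \<ge> c} + s * card {a\<in>A. z a \<ge> c}"
    using Suc.prems(1)[of c] s by (intro add_left_mono mult_left_mono) auto
  finally show ?case by simp
qed

text \<open>The median is the least attained value whose lower set holds at least half of
  \<open>A\<close>. The next smaller attained value fails this test, so at most half of
  \<open>A\<close> lies strictly below the median.\<close>

lemma finite_median:
  fixes z :: "'b \<Rightarrow> real"
  assumes A: "finite A" "A \<noteq> {}"
  obtains m where "card A \<le> 2 * card {a\<in>A. z a \<le> m}" "card A \<le> 2 * card {a\<in>A. z a \<ge> m}"
proof -
  define T where "T = {t\<in>z ` A. card A \<le> 2 * card {a\<in>A. z a \<le> t}}"
  have "{a\<in>A. z a \<le> Max (z ` A)} = A" using A by auto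
  then have "card {a\<in>A. z a \<le> Max (z ` A)} = card A" by (rule arg_cong)
  then have "Max (z ` A) \<in> T" using A unfolding T_def by (intro CollectI conjI) auto
  then have T: "finite T" "T \<noteq> {}" using A unfolding T_def by (simp, blast)
  define m where "m = Min T"
  have m: "m \<in> T" using T by (simp add: m_def)
  have "2 * card {a\<in>A. z a < m} \<le> card A"
  proof (cases "{a\<in>A. z a < m} = {}")
    case True
    then show ?thesis by (simp only: card.empty)
  next
    case False
    define t where "t = Max (z ` {a\<in>A. z a < m})"
    have t: "t \<in> z ` {a\<in>A. z a < m}" unfolding t_def using A False by (intro Max_in) auto
    have "{a\<in>A. z a < m} = {a\<in>A. z a \<le> t}"
    proof -
      have "z a \<le> t" if "a \<in> A" "z a < m" for a
        unfolding t_def by (rule Max_ge) (use A that in auto)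
      then show ?thesis using t by force
    qed
    moreover have "t \<notin> T"
    proof
      assume "t \<in> T"
      then have "m \<le> t" using T by (simp add: m_def)
      then show False using t by auto
    qed
    ultimately show ?thesis using t by (auto simp: T_def)
  qed
  moreover have "card A = card {a\<in>A. z a < m} + card {a\<in>A. z a \<ge> m}"
    using A by (subst card_Un_disjoint[symmetric]) (auto intro!: arg_cong[of _ _ card])
  ultimately have "card A \<le> 2 * card {a\<in>A. z a \<ge> m}" by simp
  then show ?thesis using m that[of m] by (auto simp: T_def)
qed

text \<open>Let \<open>p\<close> and \<open>q\<close> be the fractions of \<open>A\<close> below
  \<open>t\<close> and above \<open>t + s\<close>. Since \<open>p powr (1 / k)\<close> is at least
  \<open>p\<close>, the failure of the split forces \<open>q powr (1 / k) < 1 - p\<close>, hence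
  \<open>q\<close> is at most the \<open>k\<close>-th power of a bound on \<open>1 - p\<close>. A
  small exponent \<open>1 / k\<close> thus means very fast decay.\<close>

lemma tail_decay:
  fixes z :: "'b \<Rightarrow> real" and k :: nat
  assumes A: "finite A" "A \<noteq> {}" and k: "k \<ge> 2"
    and med: "card A \<le> 2 * card {a\<in>A. z a \<le> m}" and t: "t \<ge> m"
    and nosplit: "card {a\<in>A. z a \<ge> t + s} > 0 \<Longrightarrow>
      card {a\<in>A. z a \<le> t} powr (1 / k) + card {a\<in>A. z a \<ge> t + s} powr (1 / k) < card A powr (1 / k)"
  shows "2 * card {a\<in>A. z a \<ge> t + s} \<le> card {a\<in>A. z a \<ge> t}"
    and "real (card {a\<in>A. z a \<ge> t + s}) \<le> card A / 2 ^ k"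
proof -
  define N where "N = real (card A)"
  define p where "p = card {a\<in>A. z a \<le> t} / N"
  define q where "q = card {a\<in>A. z a \<ge> t + s} / N"
  define G where "G = card {a\<in>A. z a \<ge> t} / N"
  \<comment> \<open>Both terms bound \<open>1 - p\<close>: \<open>t\<close> is above a median, and
    every element is at most \<open>t\<close> or at least \<open>t\<close>. The term
    \<open>1/2\<close> yields the factor \<open>1 / 2 ^ k\<close>; using each term once in
    \<open>x ^ 2\<close> yields the halving.\<close>
  define x where "x = min (1/2) G"
  have N: "N > 0" using A by (simp add: N_def card_gt_0_iff)
  have q0: "q \<ge> 0" using N by (simp add: q_def)
  have p1: "p \<le> 1" using A N by (auto simp: p_def N_def field_simps intro!: card_mono)
  have "real (card {a\<in>A. z a \<le> m}) \<le> card {a\<in>A. z a \<le> t}"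
    using A t by (intro of_nat_mono card_mono) auto
  moreover have "N \<le> 2 * real (card {a\<in>A. z a \<le> m})"
    using med unfolding N_def by linarith
  ultimately have p_half: "p \<ge> 1/2" using N by (simp add: p_def field_simps)
  have "card A = card ({a\<in>A. z a \<le> t} \<union> {a\<in>A. z a \<ge> t})"
    by (rule arg_cong[of _ _ card]) auto
  also have "\<dots> \<le> card {a\<in>A. z a \<le> t} + card {a\<in>A. z a \<ge> t}" by (rule card_Un_le)
  finally have "N \<le> card {a\<in>A. z a \<le> t} + card {a\<in>A. z a \<ge> t}" by (simp add: N_def)
  then have "1 \<le> (card {a\<in>A. z a \<le> t} + card {a\<in>A. z a \<ge> t}) / N" using N by simp
  then have pG: "1 - G \<le> p" unfolding p_def G_def by (simp add: add_divide_distrib)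
  have x0: "x \<ge> 0" using N by (simp add: x_def G_def)
  have qx: "q \<le> x ^ k"
  proof (cases "card {a\<in>A. z a \<ge> t + s} > 0")
    case True
    have "p powr (1 / k) + q powr (1 / k) =
        (card {a\<in>A. z a \<le> t} powr (1 / k) + card {a\<in>A. z a \<ge> t + s} powr (1 / k)) / N powr (1 / k)"
      using N by (simp add: p_def q_def powr_divide add_divide_distrib)
    also have "\<dots> < 1" using nosplit[OF True] N by (simp add: N_def)
    finally have "q powr (1 / k) < 1 - p powr (1 / k)" by simp
    also have "p powr (1 / k) \<ge> p powr 1"
      by (rule powr_mono') (use p_half p1 k in auto)
    then have "1 - p powr (1 / k) \<le> 1 - p" using p_half by simp
    also have "\<dots> \<le> x" using pG p_half by (simp add: x_def)
    finally have "q powr (1 / k) \<le> x" by simp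
    then have "(q powr (1 / k)) ^ k \<le> x ^ k" by (intro power_mono) auto
    moreover have "(q powr (1 / k)) ^ k = q"
    proof (cases "q = 0")
      case False
      then show ?thesis using q0 k by (subst powr_realpow[symmetric]) (auto simp: powr_powr)
    qed (use k in auto)
    ultimately show ?thesis by simp
  next
    case False
    then show ?thesis using x0 by (simp add: q_def)
  qed
  have "x ^ k \<le> (1/2) ^ k" using x0 by (intro power_mono) (auto simp: x_def)
  then have "q \<le> 1 / 2 ^ k" using qx by (simp add: power_one_over)
  then show "real (card {a\<in>A. z a \<ge> t + s}) \<le> card A / 2 ^ k"
    using N by (simp add: q_def N_def field_simps)
  have "x ^ k \<le> x ^ 2" by (rule power_decreasing) (use x0 k in \<open>auto simp: x_def\<close>)
  also have "\<dots> \<le> 1/2 * G" unfolding power2_eq_square by (rule mult_mono) (use x0 in \<open>auto simp: x_def\<close>)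
  finally have "2 * q \<le> G" using qx by simp
  then have "2 * real (card {a\<in>A. z a \<ge> t + s}) \<le> card {a\<in>A. z a \<ge> t}"
    using N by (simp add: q_def G_def field_simps)
  then show "2 * card {a\<in>A. z a \<ge> t + s} \<le> card {a\<in>A. z a \<ge> t}" by linarith
qed

text \<open>The tail beyond \<open>m + s\<close> starts with at most a fraction
  \<open>1 / 2 ^ k\<close> of \<open>A\<close> and then halves at every step of length
  \<open>s\<close>. Only the lower half of the median property is assumed, so that the lemma can be
  used for \<open>z\<close> and for \<open>- z\<close>.\<close>

lemma sum_excess_nosplit:
  fixes z :: "'b \<Rightarrow> real" and k :: nat
  assumes A: "finite A" "A \<noteq> {}" and k: "k \<ge> 2" and s: "s > 0"
    and med: "card A \<le> 2 * card {a\<in>A. z a \<le> m}"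
    and nosplit: "\<And>t. card {a\<in>A. z a \<le> t} > 0 \<Longrightarrow> card {a\<in>A. z a \<ge> t + s} > 0 \<Longrightarrow>
      card {a\<in>A. z a \<le> t} powr (1 / k) + card {a\<in>A. z a \<ge> t + s} powr (1 / k) < card A powr (1 / k)"
  shows "(\<Sum>a\<in>A. max 0 (z a - (m + s))) \<le> 2 * s * (card A / 2 ^ k)"
proof -
  have pos: "card {a\<in>A. z a \<le> t} > 0" if "t \<ge> m" for t
  proof -
    have "card {a\<in>A. z a \<le> m} \<le> card {a\<in>A. z a \<le> t}"
      using A that by (intro card_mono) auto
    moreover have "card A > 0" using A by (simp add: card_gt_0_iff)
    ultimately show ?thesis using med by linarith
  qed
  have decay: "2 * card {a\<in>A. z a \<ge> t + s} \<le> card {a\<in>A. z a \<ge> t}"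
    "real (card {a\<in>A. z a \<ge> t + s}) \<le> card A / 2 ^ k" if "t \<ge> m" for t
    using tail_decay[OF A k med that, of s] nosplit[OF pos[OF that]] by blast+
  obtain n where n: "(Max (z ` A) - (m + s)) / s \<le> real n" using real_arch_simple by blast
  have "(\<Sum>a\<in>A. max 0 (z a - (m + s))) \<le> 2 * s * card {a\<in>A. z a \<ge> m + s}"
  proof (rule sum_excess_le_tail[OF A(1), where n = n])
    show "2 * card {a\<in>A. z a \<ge> t + s} \<le> card {a\<in>A. z a \<ge> t}" if "t \<ge> m + s" for t
      using decay(1)[of t] that s by simp
    show "z a \<le> m + s + real n * s" if "a \<in> A" for a
    proof -
      have "z a \<le> Max (z ` A)" using A that by simp
      also have "Max (z ` A) - (m + s) \<le> real n * s" using n s by (simp add: field_simps)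
      then have "Max (z ` A) \<le> m + s + real n * s" by simp
      finally show ?thesis .
    qed
  qed (use s in simp)
  also have "\<dots> \<le> 2 * s * (card A / 2 ^ k)"
    using decay(2)[of m] s by (intro mult_left_mono) auto
  finally show ?thesis .
qed

text \<open>Suppose that no gap is good. The values clamped to the window of radius \<open>s\<close>
  around the median contribute at most \<open>s N^2\<close> to the double sum. The parts cut off on
  either side have total at most \<open>2 s N / 2 ^ k\<close> each, and each such total enters with
  the factor \<open>2 N\<close>. This adds up to the factor \<open>1 + 8 / 2 ^ k\<close>.\<close>

lemma exists_good_split:
  fixes z :: "'b \<Rightarrow> real" and k :: nat
  assumes A: "finite A" "A \<noteq> {}" and k: "k \<ge> 2" and s: "s > 0"
    and spread: "s * (1 + 8 / 2 ^ k) * (card A)\<^sup>2 < (\<Sum>a\<in>A. \<Sum>b\<in>A. \<bar>z a - z b\<bar>)"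
  obtains r where "{a\<in>A. z a \<le> r} \<noteq> {}" "{a\<in>A. z a \<ge> r + s} \<noteq> {}"
    "card A powr (1 / k) \<le> card {a\<in>A. z a \<le> r} powr (1 / k) + card {a\<in>A. z a \<ge> r + s} powr (1 / k)"
proof (rule ccontr)
  assume neg: "\<not> thesis"
  note good = that
  let ?N = "real (card A)"
  have nosplit: "card {a\<in>A. z a \<le> r} powr (1 / k) + card {a\<in>A. z a \<ge> r + s} powr (1 / k) < ?N powr (1 / k)"
    if "card {a\<in>A. z a \<le> r} > 0" "card {a\<in>A. z a \<ge> r + s} > 0" for r
  proof (rule ccontr)
    have "{a\<in>A. z a \<le> r} \<noteq> {}" "{a\<in>A. z a \<ge> r + s} \<noteq> {}" using that by (metis card.empty less_irrefl)+
    moreover assume "\<not> ?thesis"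
    ultimately show False using neg good[of r] by (simp add: not_less)
  qed
  obtain m where m: "card A \<le> 2 * card {a\<in>A. z a \<le> m}" "card A \<le> 2 * card {a\<in>A. z a \<ge> m}"
    using finite_median[OF A] by blast
  define w where "w a = max (m - s) (min (m + s) (z a))" for a
  define u where "u a = max 0 (z a - (m + s))" for a
  define v where "v a = max 0 (- z a - (- m + s))" for a
  have u: "(\<Sum>a\<in>A. u a) \<le> 2 * s * (?N / 2 ^ k)"
    unfolding u_def by (rule sum_excess_nosplit[OF A k s m(1) nosplit])
  have v: "(\<Sum>a\<in>A. v a) \<le> 2 * s * (?N / 2 ^ k)"
    unfolding v_def
  proof (rule sum_excess_nosplit[OF A k s])
    \<comment> \<open>Negation exchanges the two sides of a gap: the gap of \<open>- z\<close> that
      starts at \<open>t\<close> is the gap of \<open>z\<close> that starts at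
      \<open>- t - s\<close>.\<close>
    have *: "{a\<in>A. - z a \<le> t} = {a\<in>A. z a \<ge> - t - s + s}"
      "{a\<in>A. - z a \<ge> t + s} = {a\<in>A. z a \<le> - t - s}" for t by auto
    show "card A \<le> 2 * card {a\<in>A. - z a \<le> - m}" using m(2) by simp
    show "card {a\<in>A. - z a \<le> t} powr (1 / k) + card {a\<in>A. - z a \<ge> t + s} powr (1 / k) < ?N powr (1 / k)"
      if "card {a\<in>A. - z a \<le> t} > 0" "card {a\<in>A. - z a \<ge> t + s} > 0" for t
      using nosplit[of "- t - s"] that unfolding * by simp
  qed
  have "(\<Sum>a\<in>A. \<Sum>b\<in>A. \<bar>z a - z b\<bar>) \<le> (\<Sum>a\<in>A. \<Sum>b\<in>A. \<bar>w a - w b\<bar> + (u a + v a) + (u b + v b))"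
  proof (intro sum_mono)
    have zw: "\<bar>z c - w c\<bar> \<le> u c + v c" for c
      using s by (simp add: w_def u_def v_def max_def min_def)
    show "\<bar>z a - z b\<bar> \<le> \<bar>w a - w b\<bar> + (u a + v a) + (u b + v b)" for a b
      using zw[of a] zw[of b] by arith
  qed
  also have "\<dots> = (\<Sum>a\<in>A. \<Sum>b\<in>A. \<bar>w a - w b\<bar>) + 2 * ?N * ((\<Sum>a\<in>A. u a) + (\<Sum>a\<in>A. v a))"
    by (simp add: sum.distrib flip: sum_distrib_left)
  also have "\<dots> \<le> (2 * s) / 2 * ?N\<^sup>2 + 2 * ?N * (2 * s * (?N / 2 ^ k) + 2 * s * (?N / 2 ^ k))"
  proof (intro add_mono mult_left_mono u v)
    show "(\<Sum>a\<in>A. \<Sum>b\<in>A. \<bar>w a - w b\<bar>) \<le> 2 * s / 2 * ?N\<^sup>2"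
      using sum_abs_diff_window_le[OF A(1), of "m - s" w "2 * s"] s by (simp add: w_def)
  qed simp
  also have "\<dots> = s * (1 + 8 / 2 ^ k) * ?N\<^sup>2" by (simp add: power2_eq_square field_simps)
  finally show False using spread by simp
qed

section \<open>Packing numbers and shattered sets with grid thresholds\<close>

definition grid :: "real \<Rightarrow> real set" where
  "grid \<eta> = (\<lambda>j. \<eta> * real j) ` {j. \<eta> * real j \<le> 1}"

lemma
  assumes "\<eta> > 0"
  shows finite_grid: "finite (grid \<eta>)" and card_grid_le: "card (grid \<eta>) \<le> 1 / \<eta> + 1"
    and grid_subset: "grid \<eta> \<subseteq> {0..1}"
proof -
  have sub: "{j. \<eta> * real j \<le> 1} \<subseteq> {..nat \<lfloor>1 / \<eta>\<rfloor>}"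
    using assms by (auto simp: le_nat_floor field_simps)
  then have fin: "finite {j. \<eta> * real j \<le> 1}" by (rule finite_subset) simp
  then show "finite (grid \<eta>)" by (simp add: grid_def)
  have "card (grid \<eta>) \<le> card {j. \<eta> * real j \<le> 1}" unfolding grid_def by (rule card_image_le[OF fin])
  also have "\<dots> \<le> card {..nat \<lfloor>1 / \<eta>\<rfloor>}" by (rule card_mono[OF _ sub]) simp
  finally have "card (grid \<eta>) \<le> nat \<lfloor>1 / \<eta>\<rfloor> + 1" by simp
  moreover have "real (nat \<lfloor>1 / \<eta>\<rfloor>) \<le> 1 / \<eta>" using assms by simp
  ultimately show "card (grid \<eta>) \<le> 1 / \<eta> + 1" by linarith
  show "grid \<eta> \<subseteq> {0..1}" using assms by (auto simp: grid_def)
qed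

lemma grid_above:
  assumes "\<eta> > 0" "0 \<le> r" "r + \<eta> \<le> 1"
  obtains r' where "r' \<in> grid \<eta>" "r \<le> r'" "r' \<le> r + \<eta>"
proof
  let ?j = "nat \<lceil>r / \<eta>\<rceil>"
  have j: "r / \<eta> \<le> real ?j" "real ?j \<le> r / \<eta> + 1"
    using assms by (auto simp: of_nat_ceiling)
  then have *: "r \<le> \<eta> * ?j" "\<eta> * ?j \<le> r + \<eta>" using assms(1) by (auto simp: field_simps)
  then show "\<eta> * ?j \<in> grid \<eta>"
    unfolding grid_def using assms by (intro imageI CollectI) linarith
  show "r \<le> \<eta> * ?j" "\<eta> * ?j \<le> r + \<eta>" by fact+
qed

text \<open>The exponent \<open>1 / k\<close> depends only on how far \<open>\<rho>\<close> exceeds \<open>s + \<eta>\<close>, which is what saves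
  a logarithm compared with splitting off a polynomially small fraction.\<close>

lemma packing_le_shats:
  fixes A :: "('i \<Rightarrow> real) set" and k :: nat and s \<eta> \<rho> N0 :: real
  assumes I: "finite I" "I \<noteq> {}" and \<eta>: "\<eta> > 0" and s: "s > 0" and k: "k \<ge> 2"
    and N0: "N0 powr (1 / k) \<le> 2" and \<rho>: "s + \<eta> < \<rho>"
    and gap: "\<And>N. N0 < N \<Longrightarrow> (s + \<eta>) * (1 + 8 / 2 ^ k) < \<rho> * (1 - 1 / N)"
    and A: "finite A"
    and range: "\<And>f x. f \<in> A \<Longrightarrow> x \<in> I \<Longrightarrow> f x \<in> {0..1}"
    and sep: "\<And>f g. f \<in> A \<Longrightarrow> g \<in> A \<Longrightarrow> f \<noteq> g \<Longrightarrow> \<rho> * card I \<le> (\<Sum>x\<in>I. \<bar>f x - g x\<bar>)"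
  shows "card A powr (1 / k) \<le> card (shats s A (I \<times> grid \<eta>))"
  using A range sep
proof (induction A rule: finite_psubset_induct)
  case (psubset A)
  let ?U = "I \<times> grid \<eta>" and ?N = "real (card A)"
  have U: "finite ?U" using I finite_grid[OF \<eta>] by simp
  have sub: "card B powr (1 / k) \<le> card (shats s B ?U)" if "B \<subset> A" for B
  proof (rule psubset.IH[OF that])
    show "f x \<in> {0..1}" if "f \<in> B" "x \<in> I" for f x
      using psubset.prems(1)[of f x] that \<open>B \<subset> A\<close> by blast
    show "\<rho> * card I \<le> (\<Sum>x\<in>I. \<bar>f x - g x\<bar>)" if "f \<in> B" "g \<in> B" "f \<noteq> g" for f g
      using psubset.prems(2)[of f g] that \<open>B \<subset> A\<close> by blast
  qed
  \<comment> \<open>A gap of width \<open>s + \<eta>\<close> leaves room to move its lower edge up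
    to a grid point and still have width \<open>s\<close>. Both parts can only grow by this, and
    they stay disjoint and nonempty, so each is a proper subset of \<open>A\<close>.\<close>
  have split: "\<exists>L H. L \<noteq> {} \<and> H \<noteq> {} \<and> L \<subset> A \<and> H \<subset> A \<and> {f\<in>A. f x \<le> r} \<subseteq> L \<and>
      {f\<in>A. r + (s + \<eta>) \<le> f x} \<subseteq> H \<and>
      card (shats s L ?U) + card (shats s H ?U) \<le> card (shats s A ?U)"
    if x: "x \<in> I" and ne: "{f\<in>A. f x \<le> r} \<noteq> {}" "{f\<in>A. r + (s + \<eta>) \<le> f x} \<noteq> {}" for x r
  proof -
    \<comment> \<open>Members on both sides of the gap place the whole gap inside
      \<open>[0, 1]\<close>, which \<open>grid_above\<close> requires.\<close>
    obtain f g where fg: "f \<in> A" "f x \<le> r" "g \<in> A" "r + (s + \<eta>) \<le> g x" using ne by blast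
    have "0 \<le> r" using fg(2) psubset.prems(1)[OF fg(1) x] by simp
    moreover have "r + (s + \<eta>) \<le> 1" using fg(4) psubset.prems(1)[OF fg(3) x] by simp
    ultimately obtain r' where r': "r' \<in> grid \<eta>" "r \<le> r'" "r' \<le> r + \<eta>"
      using grid_above[of \<eta> r] \<eta> s by auto
    let ?L = "{f\<in>A. f x \<le> r'}" and ?H = "{f\<in>A. r' + s \<le> f x}"
    have le: "{f\<in>A. f x \<le> r} \<subseteq> ?L" "{f\<in>A. r + (s + \<eta>) \<le> f x} \<subseteq> ?H" using r' by auto
    then have neL: "?L \<noteq> {}" "?H \<noteq> {}" using ne by auto
    have disj: "?L \<inter> ?H = {}" using s by auto
    have proper: "L \<subset> A" "H \<subset> A"
      if "L \<subseteq> A" "H \<subseteq> A" "L \<noteq> {}" "H \<noteq> {}" "L \<inter> H = {}" for L H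
      using that by auto
    have "?L \<subset> A" "?H \<subset> A" by (rule proper[OF _ _ neL disj]; simp)+
    moreover have "card (shats s ?L ?U) + card (shats s ?H ?U) \<le> card (shats s A ?U)"
      by (rule card_shats_split[OF U _ s]) (use x r' in auto)
    ultimately show ?thesis using le neL by (intro exI[of _ ?L] exI[of _ ?H] conjI)
  qed
  \<comment> \<open>Up to size \<open>N0\<close> the claimed lower bound is at most 2, and any split
    into two nonempty parts provides two shattered sets. Beyond \<open>N0\<close> the factor
    \<open>1 - 1 / N\<close> is close enough to 1 for a balanced split.\<close>
  consider "card A = 0" | "card A = 1" | "card A > 1" "?N \<le> N0" | "card A > 1" "?N > N0" by linarith
  then show ?case
  proof cases
    case 1 then show ?thesis by simp
  next
    case 2
    then have "A \<noteq> {}" by auto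
    then show ?thesis using card_shats_ge_1[OF U, of A s] 2 by simp
  next
    case 3
    have "\<exists>f\<in>A. \<exists>g\<in>A. f \<noteq> g"
    proof (rule ccontr)
      assume "\<not> ?thesis"
      then have "card A \<le> Suc 0" using psubset.hyps by (subst card_le_Suc0_iff_eq) auto
      then show False using 3 by simp
    qed
    then obtain f g where fg: "f \<in> A" "g \<in> A" "f \<noteq> g" by blast
    have "\<exists>x\<in>I. \<rho> \<le> \<bar>f x - g x\<bar>"
    proof (rule ccontr)
      assume "\<not> ?thesis"
      then have "(\<Sum>x\<in>I. \<bar>f x - g x\<bar>) < (\<Sum>x\<in>I. \<rho>)" using I by (intro sum_strict_mono) auto
      then show False using psubset.prems(2)[OF fg] by (simp add: mult.commute)
    qed
    then obtain x where x: "x \<in> I" "\<rho> \<le> \<bar>f x - g x\<bar>" by blast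
    \<comment> \<open>The smaller of the two values at \<open>x\<close> is a suitable lower edge,
      since the values differ by \<open>\<rho> > s + \<eta>\<close>.\<close>
    have "\<exists>r. {f\<in>A. f x \<le> r} \<noteq> {} \<and> {f\<in>A. r + (s + \<eta>) \<le> f x} \<noteq> {}"
    proof (cases "f x \<le> g x")
      case True
      then have "f \<in> {h\<in>A. h x \<le> f x}" "g \<in> {h\<in>A. f x + (s + \<eta>) \<le> h x}" using x fg \<rho> by auto
      then show ?thesis by blast
    next
      case False
      then have "g \<in> {h\<in>A. h x \<le> g x}" "f \<in> {h\<in>A. g x + (s + \<eta>) \<le> h x}" using x fg \<rho> by auto
      then show ?thesis by blast
    qed
    then obtain r where r: "{f\<in>A. f x \<le> r} \<noteq> {}" "{f\<in>A. r + (s + \<eta>) \<le> f x} \<noteq> {}" by (elim exE conjE)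
    obtain L H where LH: "L \<noteq> {}" "H \<noteq> {}"
      "card (shats s L ?U) + card (shats s H ?U) \<le> card (shats s A ?U)"
      using split[OF x(1) r] by (elim exE conjE)
    have "?N powr (1 / k) \<le> N0 powr (1 / k)" using 3 by (intro powr_mono2) auto
    also have "\<dots> \<le> 2" by (rule N0)
    also have "2 \<le> real (card (shats s A ?U))"
      using LH card_shats_ge_1[OF U LH(1), of s] card_shats_ge_1[OF U LH(2), of s] by linarith
    finally show ?thesis .
  next
    case 4
    have Ane: "A \<noteq> {}" using 4 by auto
    have "(\<Sum>x\<in>I. \<Sum>f\<in>A. \<Sum>g\<in>A. \<bar>f x - g x\<bar>) = (\<Sum>f\<in>A. \<Sum>x\<in>I. \<Sum>g\<in>A. \<bar>f x - g x\<bar>)"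
      by (rule sum.swap)
    also have "\<dots> = (\<Sum>f\<in>A. \<Sum>g\<in>A. \<Sum>x\<in>I. \<bar>f x - g x\<bar>)"
      by (intro sum.cong refl sum.swap)
    finally have swap: "(\<Sum>x\<in>I. \<Sum>f\<in>A. \<Sum>g\<in>A. \<bar>f x - g x\<bar>)
      = (\<Sum>f\<in>A. \<Sum>g\<in>A. \<Sum>x\<in>I. \<bar>f x - g x\<bar>)" .
    \<comment> \<open>There are \<open>N (N - 1)\<close> ordered pairs of distinct members, each at
      total distance at least \<open>\<rho> * card I\<close>; the diagonal accounts for the factor
      \<open>1 - 1 / N\<close> in \<open>gap\<close>.\<close>
    have "?N * ((?N - 1) * (\<rho> * card I)) = (\<Sum>f\<in>A. \<Sum>g\<in>A - {f}. \<rho> * card I)"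
      using 4 by (simp add: of_nat_diff)
    also have "\<dots> \<le> (\<Sum>f\<in>A. \<Sum>g\<in>A. \<Sum>x\<in>I. \<bar>f x - g x\<bar>)"
    proof (rule sum_mono)
      fix f assume f: "f \<in> A"
      have "(\<Sum>g\<in>A - {f}. \<rho> * card I) \<le> (\<Sum>g\<in>A - {f}. \<Sum>x\<in>I. \<bar>f x - g x\<bar>)"
        by (intro sum_mono psubset.prems(2)) (use f in auto)
      also have "\<dots> \<le> (\<Sum>g\<in>A. \<Sum>x\<in>I. \<bar>f x - g x\<bar>)"
        by (rule sum_mono2) (use psubset.hyps in \<open>auto intro: sum_nonneg\<close>)
      finally show "(\<Sum>g\<in>A - {f}. \<rho> * card I) \<le> (\<Sum>g\<in>A. \<Sum>x\<in>I. \<bar>f x - g x\<bar>)" .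
    qed
    finally have tot: "?N * ((?N - 1) * (\<rho> * card I)) \<le> (\<Sum>x\<in>I. \<Sum>f\<in>A. \<Sum>g\<in>A. \<bar>f x - g x\<bar>)"
      unfolding swap .
    \<comment> \<open>By averaging, some sample point has at least the mean spread, which by
      \<open>gap\<close> exceeds the threshold of \<open>exists_good_split\<close>.\<close>
    have "\<exists>x\<in>I. (s + \<eta>) * (1 + 8 / 2 ^ k) * ?N\<^sup>2 < (\<Sum>f\<in>A. \<Sum>g\<in>A. \<bar>f x - g x\<bar>)"
    proof (rule ccontr)
      assume "\<not> ?thesis"
      then have "(\<Sum>x\<in>I. \<Sum>f\<in>A. \<Sum>g\<in>A. \<bar>f x - g x\<bar>) \<le> (\<Sum>x\<in>I. (s + \<eta>) * (1 + 8 / 2 ^ k) * ?N\<^sup>2)"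
        by (intro sum_mono) (simp add: not_less)
      also have "\<dots> = card I * ?N\<^sup>2 * ((s + \<eta>) * (1 + 8 / 2 ^ k))" by simp
      also have "\<dots> < card I * ?N\<^sup>2 * (\<rho> * (1 - 1 / ?N))"
        using I 4 gap[of ?N] by (intro mult_strict_left_mono) (auto simp: card_gt_0_iff)
      also have "\<dots> = ?N * ((?N - 1) * (\<rho> * card I))"
        using 4 by (simp add: power2_eq_square field_simps)
      finally show False using tot by simp
    qed
    then obtain x where x: "x \<in> I"
        "(s + \<eta>) * (1 + 8 / 2 ^ k) * ?N\<^sup>2 < (\<Sum>f\<in>A. \<Sum>g\<in>A. \<bar>f x - g x\<bar>)" by blast
    obtain r where r: "{f\<in>A. f x \<le> r} \<noteq> {}" "{f\<in>A. r + (s + \<eta>) \<le> f x} \<noteq> {}"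
      "?N powr (1 / k) \<le> card {f\<in>A. f x \<le> r} powr (1 / k) + card {f\<in>A. r + (s + \<eta>) \<le> f x} powr (1 / k)"
      by (rule exists_good_split[OF psubset.hyps Ane k, of "s + \<eta>" "\<lambda>f. f x"]) (use s \<eta> x(2) in auto)
    obtain L H where LH: "L \<subset> A" "H \<subset> A" "{f\<in>A. f x \<le> r} \<subseteq> L" "{f\<in>A. r + (s + \<eta>) \<le> f x} \<subseteq> H"
      "card (shats s L ?U) + card (shats s H ?U) \<le> card (shats s A ?U)"
      using split[OF x(1) r(1,2)] by (elim exE conjE)
    have fin: "finite L" "finite H" using LH psubset.hyps by (auto intro: finite_subset)
    \<comment> \<open>The split is balanced in the sense that the powers of the part sizes add up to
      at least that of \<open>A\<close>; induction turns these powers into numbers of shattered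
      sets, which superadditivity combines.\<close>
    note r(3)
    also have "card {f\<in>A. f x \<le> r} powr (1 / k) + card {f\<in>A. r + (s + \<eta>) \<le> f x} powr (1 / k)
        \<le> card L powr (1 / k) + card H powr (1 / k)"
      by (intro add_mono powr_mono2 of_nat_mono card_mono fin LH) auto
    also have "\<dots> \<le> real (card (shats s L ?U)) + card (shats s H ?U)"
      by (intro add_mono sub LH)
    also have "\<dots> \<le> card (shats s A ?U)" using LH(5) by linarith
    finally show ?thesis .
  qed
qed

section \<open>Tail bound for random signs\<close>

text \<open>For \<open>y >= 0\<close> this is the logarithmic inequality behind Hoeffding's lemma,
  taken with probability \<open>1 / 2\<close> and argument \<open>2 y\<close>; negative
  \<open>y\<close> follows by symmetry.\<close>

lemma exp_add_exp_minus_le: "exp y + exp (- y) \<le> 2 * exp (y\<^sup>2 / 2)" for y :: real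
proof -
  have *: "exp y + exp (- y) \<le> 2 * exp (y\<^sup>2 / 2)" if "y \<ge> 0" for y :: real
  proof -
    have "- (2 * y) * (1 / 2) + ln (1 + 1 / 2 * (exp (2 * y) - 1)) \<le> (2 * y)\<^sup>2 / 8"
      by (rule Hoeffdings_lemma_aux) (use that in auto)
    then have "ln ((1 + exp (2 * y)) / 2) \<le> y + y\<^sup>2 / 2"
      by (simp add: power_mult_distrib field_simps)
    then have "exp (ln ((1 + exp (2 * y)) / 2)) \<le> exp (y + y\<^sup>2 / 2)" by simp
    then have "(1 + exp (2 * y)) / 2 \<le> exp (y + y\<^sup>2 / 2)"
      by (subst (asm) exp_ln) (auto simp: add_pos_pos)
    then have "exp (- y) * (1 + exp (2 * y)) \<le> exp (- y) * (2 * exp (y + y\<^sup>2 / 2))"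
      by (intro mult_left_mono) auto
    then show ?thesis by (simp add: distrib_left mult.left_commute flip: exp_add)
  qed
  show ?thesis using *[of y] *[of "- y"] by (cases "y \<ge> 0") (auto simp: add.commute)
qed

text \<open>A vector of signs is coded by the set \<open>S\<close> of flipped indices. The
  exponential of the signed sum is a product over indices, so summing over all \<open>S\<close>
  factorises into one hyperbolic cosine per index.\<close>

lemma sum_exp_signs_le:
  fixes a :: "nat \<Rightarrow> real"
  assumes a: "\<And>i. i < m \<Longrightarrow> \<bar>a i\<bar> \<le> 1"
  shows "(\<Sum>S\<in>Pow {..<m}. exp (c * (\<Sum>i<m. if i \<in> S then - a i else a i))) \<le> 2 ^ m * exp (m * c\<^sup>2 / 2)"
proof -
  have "(\<Sum>S\<in>Pow {..<m}. exp (c * (\<Sum>i<m. if i \<in> S then - a i else a i)))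
      = (\<Sum>S\<in>Pow {..<m}. (\<Prod>i\<in>S. exp (- (c * a i))) * (\<Prod>i\<in>{..<m} - S. exp (c * a i)))"
  proof (rule sum.cong[OF refl])
    fix S assume "S \<in> Pow {..<m}"
    then have S: "S \<subseteq> {..<m}" by simp
    have "exp (c * (\<Sum>i<m. if i \<in> S then - a i else a i))
        = (\<Prod>i<m. if i \<in> S then exp (- (c * a i)) else exp (c * a i))"
      unfolding sum_distrib_left by (subst exp_sum) (auto intro!: prod.cong)
    also have "\<dots> = (\<Prod>i\<in>{..<m} \<inter> S. exp (- (c * a i))) * (\<Prod>i\<in>{..<m} \<inter> - S. exp (c * a i))"
      using prod.If_cases[of "{..<m}" "\<lambda>i. i \<in> S"] by simp
    also have "{..<m} \<inter> S = S" using S by auto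
    also have "{..<m} \<inter> - S = {..<m} - S" by auto
    finally show "exp (c * (\<Sum>i<m. if i \<in> S then - a i else a i))
      = (\<Prod>i\<in>S. exp (- (c * a i))) * (\<Prod>i\<in>{..<m} - S. exp (c * a i))" .
  qed
  also have "\<dots> = (\<Prod>i<m. exp (- (c * a i)) + exp (c * a i))"
    by (rule prod_add[symmetric]) simp
  also have "\<dots> \<le> (\<Prod>i<m. 2 * exp (c\<^sup>2 / 2))"
  proof (rule prod_mono, safe)
    fix i assume "i < m"
    then have "(a i)\<^sup>2 \<le> 1" using a by (simp add: abs_square_le_1)
    then have "(c * a i)\<^sup>2 \<le> c\<^sup>2" unfolding power_mult_distrib by (intro mult_left_le) auto
    then have "exp ((c * a i)\<^sup>2 / 2) \<le> exp (c\<^sup>2 / 2)" by simp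
    then show "exp (- (c * a i)) + exp (c * a i) \<le> 2 * exp (c\<^sup>2 / 2)"
      using exp_add_exp_minus_le[of "c * a i"] by linarith
  qed (simp add: add_nonneg_nonneg)
  also have "\<dots> = 2 ^ m * exp (m * c\<^sup>2 / 2)"
    by (simp add: power_mult_distrib flip: exp_of_nat_mult)
  finally show ?thesis .
qed

text \<open>The exponential moment method, with both tails treated at once. The parameter of the
  exponential is \<open>t\<close> itself, which optimises the exponent to
  \<open>m t^2 / 2 - m t^2\<close>.\<close>

lemma card_signs_le:
  fixes a :: "nat \<Rightarrow> real"
  assumes a: "\<And>i. i < m \<Longrightarrow> \<bar>a i\<bar> \<le> 1" and t: "t \<ge> 0"
  shows "card {S\<in>Pow {..<m}. m * t \<le> \<bar>\<Sum>i<m. if i \<in> S then - a i else a i\<bar>}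
           \<le> 2 ^ m * (2 * exp (- (m * t\<^sup>2 / 2)))"
proof -
  define h where "h S = (\<Sum>i<m. if i \<in> S then - a i else a i)" for S
  let ?B = "{S\<in>Pow {..<m}. m * t \<le> \<bar>h S\<bar>}"
  have "card ?B * exp (m * t\<^sup>2) = (\<Sum>S\<in>?B. exp (t * (m * t)))"
    by (simp add: power2_eq_square mult_ac)
  also have "\<dots> \<le> (\<Sum>S\<in>?B. exp (t * h S) + exp (- t * h S))"
  proof (rule sum_mono)
    fix S assume "S \<in> ?B"
    then have "t * (m * t) \<le> t * \<bar>h S\<bar>" using t by (intro mult_left_mono) auto
    then have "t * (m * t) \<le> t * h S \<or> t * (m * t) \<le> - t * h S" by (auto simp: abs_if split: if_splits)
    then show "exp (t * (m * t)) \<le> exp (t * h S) + exp (- t * h S)"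
      by (metis exp_le_cancel_iff add_increasing add_increasing2 exp_ge_zero)
  qed
  also have "\<dots> \<le> (\<Sum>S\<in>Pow {..<m}. exp (t * h S) + exp (- t * h S))"
    by (rule sum_mono2) (auto simp: add_nonneg_nonneg)
  also have "\<dots> = (\<Sum>S\<in>Pow {..<m}. exp (t * h S)) + (\<Sum>S\<in>Pow {..<m}. exp (- t * h S))"
    by (rule sum.distrib)
  also have "\<dots> \<le> 2 ^ m * exp (m * t\<^sup>2 / 2) + 2 ^ m * exp (m * (- t)\<^sup>2 / 2)"
    unfolding h_def by (intro add_mono sum_exp_signs_le a)
  finally have "card ?B * exp (m * t\<^sup>2) \<le> 2 ^ m * 2 * exp (m * t\<^sup>2 / 2)" by simp
  then have "card ?B * exp (m * t\<^sup>2) * exp (- (m * t\<^sup>2)) \<le> 2 ^ m * 2 * exp (m * t\<^sup>2 / 2) * exp (- (m * t\<^sup>2))"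
    by (rule mult_right_mono) simp
  then show ?thesis unfolding h_def by (simp add: mult.assoc flip: exp_add)
qed

section \<open>Symmetrization\<close>

lemma space_eq_of_sets_Pow: "sets D = Pow X \<Longrightarrow> space D = X"
  by (metis Pow_top Union_Pow_eq sets.sets_into_space sets.top subset_antisym PowD)

text \<open>The finite product of a countable space is countable and its points are measurable
  boxes. This settles measurability of every event on samples below.\<close>

lemma sets_PiM_eq_Pow:
  assumes "finite I" "countable X" "sets D = Pow X"
  shows "sets (PiM I (\<lambda>_. D)) = Pow (PiE I (\<lambda>_. X))"
proof (rule sets_eq_countable)
  show "countable (PiE I (\<lambda>_. X))" using assms by (intro countable_PiE) auto
  show "space (PiM I (\<lambda>_. D)) = PiE I (\<lambda>_. X)"
    by (simp add: space_PiM space_eq_of_sets_Pow[OF assms(3)])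
  fix x assume x: "x \<in> PiE I (\<lambda>_. X)"
  then have "{x} = PiE I (\<lambda>i. {x i})" using PiE_singleton[of x I] by (auto simp: PiE_def)
  also have "\<dots> \<in> sets (PiM I (\<lambda>_. D))"
    using x assms by (intro sets_PiM_I_finite) (auto simp: PiE_def Pi_def)
  finally show "{x} \<in> sets (PiM I (\<lambda>_. D))" .
qed

text \<open>Hoeffding's inequality for the coordinates of a product measure. The index set is
  arbitrary because the lemma is applied to the second half \<open>{m..<2*m}\<close> of a double
  sample.\<close>

lemma prob_sample_sum_deviates_le:
  fixes f :: "'a \<Rightarrow> real"
  assumes X: "countable X" and D: "prob_space D" "sets D = Pow X"
    and f: "\<And>x. x \<in> X \<Longrightarrow> f x \<in> {0..1}" and J: "finite J" "J \<noteq> {}" and e: "e \<ge> 0"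
  shows "measure (PiM J (\<lambda>_. D))
           {y \<in> space (PiM J (\<lambda>_. D)). e \<le> \<bar>(\<Sum>j\<in>J. f (y j)) - card J * (\<integral>x. f x \<partial>D)\<bar>}
         \<le> 2 * exp (- 2 * e\<^sup>2 / card J)"
proof -
  let ?M = "PiM J (\<lambda>_. D)"
  interpret D: prob_space D by fact
  interpret M: prob_space ?M by (intro prob_space_PiM D)
  have sp: "space D = X" by (rule space_eq_of_sets_Pow[OF D(2)])
  have fm [measurable]: "f \<in> borel_measurable D" by (simp add: measurable_def D(2) sp)
  have comp: "distr ?M D (\<lambda>\<omega>. \<omega> i) = D" if "i \<in> J" for i
    using distr_PiM_component[of J "\<lambda>_. D" i] that D by simp
  have "M.indep_vars (\<lambda>_. D) (\<lambda>i \<omega>. \<omega> i) J"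
  proof (subst M.indep_vars_iff_distr_eq_PiM')
    have "distr ?M ?M (\<lambda>x. \<lambda>i\<in>J. x i) = distr ?M ?M (\<lambda>x. x)"
      by (intro distr_cong) (auto simp: space_PiM)
    also have "\<dots> = PiM J (\<lambda>i. distr ?M D (\<lambda>\<omega>. \<omega> i))"
      using comp by (simp cong: PiM_cong)
    finally show "distr ?M ?M (\<lambda>x. \<lambda>i\<in>J. x i) = PiM J (\<lambda>i. distr ?M D (\<lambda>\<omega>. \<omega> i))" .
  qed (use J in auto)
  then have ind: "M.indep_vars (\<lambda>_. borel) (\<lambda>i \<omega>. f (\<omega> i)) J"
    by (rule M.indep_vars_compose2) simp
  have dist: "distr ?M borel (\<lambda>\<omega>. f (\<omega> i)) = distr D borel f" if "i \<in> J" for i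
  proof -
    have "distr D borel f = distr (distr ?M D (\<lambda>\<omega>. \<omega> i)) borel f" using comp[OF that] by simp
    also have "\<dots> = distr ?M borel (f \<circ> (\<lambda>\<omega>. \<omega> i))" by (rule distr_distr) (use that in auto)
    finally show ?thesis by (simp add: comp_def)
  qed
  obtain i0 where i0: "i0 \<in> J" using J by auto
  have int: "(\<integral>\<omega>. f (\<omega> i0) \<partial>?M) = (\<integral>x. f x \<partial>D)"
  proof -
    have "(\<integral>x. f x \<partial>distr ?M D (\<lambda>\<omega>. \<omega> i0)) = (\<integral>\<omega>. f (\<omega> i0) \<partial>?M)"
      by (rule integral_distr) (use i0 in auto)
    then show ?thesis using comp[OF i0] by simp
  qed
  interpret H: Hoeffding_ineq_iid ?M J "\<lambda>i \<omega>. f (\<omega> i)" "\<lambda>\<omega>. f (\<omega> i0)" 0 1 "\<integral>x. f x \<partial>D"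
  proof unfold_locales
    show "AE \<omega> in ?M. f (\<omega> i0) \<in> {0..1}"
      by (rule AE_I2) (use f i0 in \<open>auto simp: space_PiM sp PiE_def Pi_def\<close>)
  qed (use J ind i0 dist int in auto)
  show ?thesis
    using H.Hoeffding_ineq_abs_ge[OF e] J by simp
qed

text \<open>By invariance, the measure of \<open>E\<close> is the average over \<open>S\<close> of
  the measures of the preimages of \<open>E\<close>. Exchanging sum and integral makes it the
  integral of the fraction of transformations that send \<open>z\<close> into \<open>E\<close>,
  which is at most \<open>B\<close> at every point.\<close>

lemma measure_le_of_invariant_family:
  fixes B :: real
  assumes "prob_space M" and W: "finite W" "W \<noteq> {}"
    and t: "\<And>S. S \<in> W \<Longrightarrow> t S \<in> measurable M M" "\<And>S. S \<in> W \<Longrightarrow> distr M M (t S) = M"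
    and E: "E \<in> sets M"
    and B: "\<And>z. z \<in> space M \<Longrightarrow> card {S\<in>W. t S z \<in> E} \<le> card W * B"
  shows "measure M E \<le> B"
proof -
  interpret prob_space M by fact
  have vim: "t S -` E \<inter> space M \<in> sets M" if "S \<in> W" for S
    using measurable_sets[OF t(1)[OF that] E] .
  have int: "integrable M (indicat_real (t S -` E \<inter> space M))" if "S \<in> W" for S
    by (rule integrable_real_indicator[OF vim[OF that]]) (simp add: emeasure_eq_measure)
  have "card W * measure M E = (\<Sum>S\<in>W. measure (distr M M (t S)) E)" using t(2) by simp
  also have "\<dots> = (\<Sum>S\<in>W. measure M (t S -` E \<inter> space M))"
    by (intro sum.cong refl measure_distr t E)
  also have "\<dots> = (\<Sum>S\<in>W. \<integral>z. indicator (t S -` E \<inter> space M) z \<partial>M)"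
    by (intro sum.cong refl) (simp add: vim)
  also have "\<dots> = (\<integral>z. (\<Sum>S\<in>W. indicator (t S -` E \<inter> space M) z) \<partial>M)"
    by (rule Bochner_Integration.integral_sum[symmetric]) (rule int)
  also have "\<dots> \<le> (\<integral>z. card W * B \<partial>M)"
  proof (rule integral_mono)
    fix z assume z: "z \<in> space M"
    have "(\<Sum>S\<in>W. indicator (t S -` E \<inter> space M) z) = (\<Sum>S\<in>W. if t S z \<in> E then 1 else 0 :: real)"
      by (rule sum.cong[OF refl]) (use z in \<open>auto simp: indicator_def\<close>)
    also have "\<dots> = card {S\<in>W. t S z \<in> E}"
      using W by (simp add: sum.If_cases Int_def)
    finally show "(\<Sum>S\<in>W. indicator (t S -` E \<inter> space M) z) \<le> card W * B" using B[OF z] by simp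
  qed (auto intro!: Bochner_Integration.integrable_sum int)
  finally have "card W * measure M E \<le> card W * B" by (simp add: prob_space)
  then show ?thesis using W by (simp add: card_gt_0_iff)
qed

text \<open>\<open>S\<close> selects the pairs \<open>(i, m + i)\<close> of a double sample to be
  exchanged, so averaging over \<open>S\<close> plays the role of random signs. The restriction
  keeps the result in the extensional product space.\<close>

definition swap_halves :: "nat \<Rightarrow> nat set \<Rightarrow> (nat \<Rightarrow> 'a) \<Rightarrow> nat \<Rightarrow> 'a" where
  "swap_halves m S z = (\<lambda>n\<in>{..<2*m}. z (if n < m then (if n \<in> S then n + m else n)
                                   else (if n - m \<in> S then n - m else n)))"

lemma distr_swap_halves:
  assumes "prob_space D"
  shows "distr (PiM {..<2*m} (\<lambda>_. D)) (PiM {..<2*m} (\<lambda>_. D)) (swap_halves m S) = PiM {..<2*m} (\<lambda>_. D)"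
  unfolding swap_halves_def
  by (rule distr_PiM_reindex[where M = "\<lambda>_. D"])
    (use assms in \<open>auto simp: inj_on_def split: if_splits\<close>)

lemma sum_swap_halves_diff:
  fixes f :: "'a \<Rightarrow> real"
  shows "(\<Sum>i<m. f (swap_halves m S z i) - f (swap_halves m S z (m + i)))
           = (\<Sum>i<m. if i \<in> S then - (f (z i) - f (z (m + i))) else f (z i) - f (z (m + i)))"
  by (rule sum.cong) (auto simp: swap_halves_def add.commute)

text \<open>For a fixed double sample \<open>z\<close>, a swap changes only the signs of the
  differences between the halves. A function and its net point have signed sums differing by at most
  \<open>2 m \<rho>\<close>, so a deviation above \<open>m (t + 2 \<rho>)\<close> for the function
  leaves at least \<open>m t\<close> for the net point. A union bound over the net and the tail
  bound for signs finish the proof.\<close>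

lemma measure_double_sample_le:
  fixes F :: "('a \<Rightarrow> real) set" and N \<rho> t :: real and m :: nat
  assumes X: "countable X" and D: "prob_space D" "sets D = Pow X" and t: "t \<ge> 0"
    and net: "\<And>z. z \<in> {..<2*m} \<rightarrow>\<^sub>E X \<Longrightarrow> \<exists>G. finite G \<and> card G \<le> N \<and>
      (\<forall>g\<in>G. \<forall>j<2*m. g j \<in> {0..1::real}) \<and>
      (\<forall>f\<in>F. \<exists>g\<in>G. (\<Sum>j<2*m. \<bar>f (z j) - g j\<bar>) \<le> \<rho> * (2 * m))"
  shows "measure (PiM {..<2*m} (\<lambda>_. D))
      {z \<in> {..<2*m} \<rightarrow>\<^sub>E X. \<exists>f\<in>F. m * (t + 2 * \<rho>) < \<bar>\<Sum>i<m. f (z i) - f (z (m + i))\<bar>}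
    \<le> N * (2 * exp (- (m * t\<^sup>2 / 2)))"
    (is "measure ?M ?E \<le> _")
proof (rule measure_le_of_invariant_family[where W = "Pow {..<m}" and t = "swap_halves m"])
  have sets: "sets ?M = Pow ({..<2*m} \<rightarrow>\<^sub>E X)" by (rule sets_PiM_eq_Pow) (use X D in auto)
  have sp: "space ?M = {..<2*m} \<rightarrow>\<^sub>E X" by (rule space_eq_of_sets_Pow[OF sets])
  have swap_in: "swap_halves m S z \<in> {..<2*m} \<rightarrow>\<^sub>E X" if "z \<in> {..<2*m} \<rightarrow>\<^sub>E X" for S z
    using that by (auto simp: swap_halves_def PiE_def Pi_def)
  show "prob_space ?M" by (intro prob_space_PiM D)
  show "finite (Pow {..<m})" "Pow {..<m} \<noteq> {}" by auto
  show "swap_halves m S \<in> measurable ?M ?M" for S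
    using swap_in by (auto simp: measurable_def sets sp)
  show "distr ?M ?M (swap_halves m S) = ?M" for S by (rule distr_swap_halves[OF D(1)])
  show "?E \<in> sets ?M" by (auto simp: sets)
  fix z assume "z \<in> space ?M"
  then have z: "z \<in> {..<2*m} \<rightarrow>\<^sub>E X" by (simp add: sp)
  \<comment> \<open>One net serves all swaps of \<open>z\<close>, because the approximation error
    sums over both halves and does not see \<open>S\<close>.\<close>
  obtain G where G: "finite G" "card G \<le> N" "\<And>g j. g \<in> G \<Longrightarrow> j < 2*m \<Longrightarrow> g j \<in> {0..1::real}"
      "\<And>f. f \<in> F \<Longrightarrow> \<exists>g\<in>G. (\<Sum>j<2*m. \<bar>f (z j) - g j\<bar>) \<le> \<rho> * (2 * m)"
    using net[OF z] by blast
  define h where "h a S = (\<Sum>i<m. if i \<in> S then - (a i - a (m + i)) else a i - a (m + i))"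
    for a :: "nat \<Rightarrow> real" and S
  let ?B = "\<lambda>g. {S\<in>Pow {..<m}. m * t \<le> \<bar>h g S\<bar>}"
  have sub: "{S\<in>Pow {..<m}. swap_halves m S z \<in> ?E} \<subseteq> (\<Union>g\<in>G. ?B g)"
  proof
    fix S assume "S \<in> {S\<in>Pow {..<m}. swap_halves m S z \<in> ?E}"
    then obtain f where S: "S \<in> Pow {..<m}" and f: "f \<in> F"
      and "m * (t + 2 * \<rho>) < \<bar>\<Sum>i<m. f (swap_halves m S z i) - f (swap_halves m S z (m + i))\<bar>" by auto
    then have dev: "m * (t + 2 * \<rho>) < \<bar>h (\<lambda>j. f (z j)) S\<bar>" by (simp only: sum_swap_halves_diff h_def)
    obtain g where g: "g \<in> G" "(\<Sum>j<2*m. \<bar>f (z j) - g j\<bar>) \<le> \<rho> * (2 * m)" using G(4)[OF f] by blast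
    have "h (\<lambda>j. f (z j)) S - h g S = (\<Sum>i<m. (if i \<in> S then - (f (z i) - f (z (m + i))) else f (z i) - f (z (m + i)))
        - (if i \<in> S then - (g i - g (m + i)) else g i - g (m + i)))"
      by (simp add: h_def sum_subtractf)
    also have "\<bar>\<dots>\<bar> \<le> (\<Sum>i<m. \<bar>f (z i) - g i\<bar> + \<bar>f (z (m + i)) - g (m + i)\<bar>)"
      by (rule order_trans[OF sum_abs sum_mono]) auto
    also have "\<dots> = (\<Sum>i<m. \<bar>f (z i) - g i\<bar>) + (\<Sum>i<m. \<bar>f (z (m + i)) - g (m + i)\<bar>)"
      by (rule sum.distrib)
    also have "(\<Sum>i<m. \<bar>f (z (m + i)) - g (m + i)\<bar>) = (\<Sum>j\<in>{m..<2*m}. \<bar>f (z j) - g j\<bar>)"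
      using sum.atLeastLessThan_shift_0[of "\<lambda>j. \<bar>f (z j) - g j\<bar>" m "2*m"]
      by (simp add: atLeast0LessThan comp_def)
    also have "(\<Sum>i<m. \<bar>f (z i) - g i\<bar>) + \<dots> = (\<Sum>j<2*m. \<bar>f (z j) - g j\<bar>)"
      by (subst sum.union_disjoint[symmetric]) (auto intro!: sum.cong)
    finally have "m * t \<le> \<bar>h g S\<bar>" using dev g(2) by (simp add: algebra_simps)
    then show "S \<in> (\<Union>g\<in>G. ?B g)" using g S by blast
  qed
  have "card {S\<in>Pow {..<m}. swap_halves m S z \<in> ?E} \<le> card (\<Union>g\<in>G. ?B g)"
    by (rule card_mono[OF _ sub]) (use G in auto)
  also have "\<dots> \<le> (\<Sum>g\<in>G. card (?B g))" by (rule card_UN_le[OF G(1)])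
  finally have "real (card {S\<in>Pow {..<m}. swap_halves m S z \<in> ?E}) \<le> (\<Sum>g\<in>G. real (card (?B g)))"
    by (simp flip: of_nat_sum)
  also have "\<dots> \<le> (\<Sum>g\<in>G. 2 ^ m * (2 * exp (- (m * t\<^sup>2 / 2))))"
    unfolding h_def
  proof (intro sum_mono card_signs_le t)
    fix g i assume "g \<in> G" "i < m"
    then have "g i \<in> {0..1}" "g (m + i) \<in> {0..1}" using G(3)[of g i] G(3)[of g "m + i"] by simp_all
    then show "\<bar>g i - g (m + i)\<bar> \<le> 1" by auto
  qed
  also have "\<dots> = card G * (2 ^ m * (2 * exp (- (m * t\<^sup>2 / 2))))" by simp
  also have "\<dots> \<le> N * (2 ^ m * (2 * exp (- (m * t\<^sup>2 / 2))))"
    by (intro mult_right_mono G) auto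
  finally show "real (card {S\<in>Pow {..<m}. swap_halves m S z \<in> ?E})
      \<le> real (card (Pow {..<m})) * (N * (2 * exp (- (m * t\<^sup>2 / 2))))"
    by (simp add: card_Pow mult_ac)
qed

text \<open>Whenever the first half has a bad function, an independent second half is accurate to
  within \<open>u\<close> for that function with probability at least \<open>1 / 2\<close>, and then
  the two halves disagree by more than \<open>m * v\<close>. Integrating over the first half gives
  the factor 2.\<close>

lemma measure_le_double_sample:
  fixes F :: "('a \<Rightarrow> real) set" and m :: nat and u v :: real
  assumes X: "countable X" and D: "prob_space D" "sets D = Pow X" and F: "F \<subseteq> X \<rightarrow> {0..1}"
    and m: "m > 0" and u: "u \<ge> 0" and small: "2 * exp (- 2 * m * u\<^sup>2) \<le> 1 / 2"
  shows "measure (PiM {..<m} (\<lambda>_. D))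
      {x \<in> space (PiM {..<m} (\<lambda>_. D)). \<exists>f\<in>F. \<bar>(1 / m) * (\<Sum>i<m. f (x i)) - (\<integral>y. f y \<partial>D)\<bar> > v + u}
    \<le> 2 * measure (PiM {..<2*m} (\<lambda>_. D))
      {z \<in> {..<2*m} \<rightarrow>\<^sub>E X. \<exists>f\<in>F. m * v < \<bar>\<Sum>i<m. f (z i) - f (z (m + i))\<bar>}"
    (is "measure ?M1 ?E1 \<le> 2 * measure ?M ?E")
proof -
  interpret D: prob_space D by fact
  interpret P: product_sigma_finite "\<lambda>_::nat. D" ..
  let ?M2 = "PiM {m..<2*m} (\<lambda>_. D)"
  interpret M1: prob_space ?M1 by (intro prob_space_PiM D)
  interpret M2: prob_space ?M2 by (intro prob_space_PiM D)
  interpret M: prob_space ?M by (intro prob_space_PiM D)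
  have spD: "space D = X" by (rule space_eq_of_sets_Pow[OF D(2)])
  have s1: "sets ?M1 = Pow ({..<m} \<rightarrow>\<^sub>E X)" and s2: "sets ?M2 = Pow ({m..<2*m} \<rightarrow>\<^sub>E X)"
    and s: "sets ?M = Pow ({..<2*m} \<rightarrow>\<^sub>E X)"
    by (simp_all add: sets_PiM_eq_Pow X D)
  have sp1: "space ?M1 = {..<m} \<rightarrow>\<^sub>E X" and sp2: "space ?M2 = {m..<2*m} \<rightarrow>\<^sub>E X"
    by (simp_all add: space_PiM spD)
  have un: "{..<m} \<union> {m..<2*m} = {..<2*m}" by auto
  let ?mg = "\<lambda>x y. merge {..<m} {m..<2*m} (x, y)"
  have half: "1 / 2 \<le> measure ?M2 {y \<in> space ?M2. ?mg x y \<in> ?E}" if x: "x \<in> ?E1" for x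
  proof -
    have xX: "x \<in> {..<m} \<rightarrow>\<^sub>E X" using x by (simp add: sp1)
    obtain f where f: "f \<in> F" "\<bar>(1 / m) * (\<Sum>i<m. f (x i)) - (\<integral>y. f y \<partial>D)\<bar> > v + u" using x by auto
    have fX: "f y \<in> {0..1}" if "y \<in> X" for y using F f(1) that by blast
    define \<mu> where "\<mu> = (\<integral>y. f y \<partial>D)"
    \<comment> \<open>The function \<open>f\<close> was chosen from \<open>x\<close> alone, so it is
      fixed while \<open>y\<close> varies and Hoeffding's inequality for one function
      applies.\<close>
    let ?B = "{y \<in> space ?M2. m * u \<le> \<bar>(\<Sum>j\<in>{m..<2*m}. f (y j)) - card {m..<2*m} * (\<integral>y. f y \<partial>D)\<bar>}"
    have "measure ?M2 ?B \<le> 2 * exp (- 2 * (m * u)\<^sup>2 / card {m..<2*m})"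
      by (rule prob_sample_sum_deviates_le[OF X D fX]) (use m u in auto)
    also have "\<dots> = 2 * exp (- 2 * m * u\<^sup>2)"
      using m by (simp add: power2_eq_square field_simps)
    finally have B: "measure ?M2 ?B \<le> 1 / 2" using small by linarith
    have "1 - measure ?M2 ?B = measure ?M2 (space ?M2 - ?B)"
      by (rule M2.prob_compl[symmetric]) (auto simp: s2 sp2)
    also have "\<dots> \<le> measure ?M2 {y \<in> space ?M2. ?mg x y \<in> ?E}"
    proof (rule M2.finite_measure_mono)
      show "space ?M2 - ?B \<subseteq> {y \<in> space ?M2. ?mg x y \<in> ?E}"
      proof
        fix y assume y: "y \<in> space ?M2 - ?B"
        have "?mg x y \<in> {..<2*m} \<rightarrow>\<^sub>E X"
          using xX y unfolding sp2 un[symmetric] by (auto simp: merge_def PiE_def Pi_def extensional_def)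
        moreover have "m * v < \<bar>\<Sum>i<m. f (?mg x y i) - f (?mg x y (m + i))\<bar>"
        proof -
          have "(\<Sum>i<m. f (?mg x y i) - f (?mg x y (m + i))) = (\<Sum>i<m. f (x i) - f (y (m + i)))"
            by (rule sum.cong) (auto simp: merge_def)
          also have "\<dots> = (\<Sum>i<m. f (x i)) - (\<Sum>i<m. f (y (m + i)))" by (rule sum_subtractf)
          also have "(\<Sum>i<m. f (y (m + i))) = (\<Sum>j\<in>{m..<2*m}. f (y j))"
            using sum.atLeastLessThan_shift_0[of "\<lambda>j. f (y j)" m "2*m"]
            by (simp add: atLeast0LessThan comp_def)
          finally have eq: "(\<Sum>i<m. f (?mg x y i) - f (?mg x y (m + i)))
            = (\<Sum>i<m. f (x i)) - (\<Sum>j\<in>{m..<2*m}. f (y j))" .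
          have "\<bar>(\<Sum>j\<in>{m..<2*m}. f (y j)) - m * \<mu>\<bar> < m * u" using y by (auto simp: \<mu>_def)
          moreover have "m * (v + u) < m * \<bar>(1 / m) * (\<Sum>i<m. f (x i)) - \<mu>\<bar>"
            using f(2) m by (intro mult_strict_left_mono) (auto simp: \<mu>_def)
          then have "m * v + m * u < \<bar>(\<Sum>i<m. f (x i)) - m * \<mu>\<bar>"
            using m by (simp add: abs_mult_pos' algebra_simps)
          ultimately show ?thesis unfolding eq by arith
        qed
        ultimately show "y \<in> {y \<in> space ?M2. ?mg x y \<in> ?E}" using f(1) y by auto
      qed
    qed (auto simp: s2 sp2)
    finally show ?thesis using B by simp
  qed
  have "emeasure ?M ?E = (\<integral>\<^sup>+z. indicator ?E z \<partial>?M)"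
    by (rule nn_integral_indicator[symmetric]) (auto simp: s)
  \<comment> \<open>Fubini: the double sample is the merge of independent samples indexed by
    \<open>{..<m}\<close> and \<open>{m..<2*m}\<close>.\<close>
  also have "\<dots> = (\<integral>\<^sup>+x. (\<integral>\<^sup>+y. indicator ?E (?mg x y) \<partial>?M2) \<partial>?M1)"
  proof -
    have "indicator ?E \<in> borel_measurable ?M" by (rule borel_measurable_indicator) (auto simp: s)
    then have "indicator ?E \<in> borel_measurable (PiM ({..<m} \<union> {m..<2*m}) (\<lambda>_. D))" unfolding un .
    then show ?thesis
      by (subst un[symmetric], intro P.product_nn_integral_fold) auto
  qed
  also have "\<dots> \<ge> (\<integral>\<^sup>+x. ennreal (1 / 2) * indicator ?E1 x \<partial>?M1)"
  proof (rule nn_integral_mono)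
    fix x assume "x \<in> space ?M1"
    show "ennreal (1 / 2) * indicator ?E1 x \<le> (\<integral>\<^sup>+y. indicator ?E (?mg x y) \<partial>?M2)"
    proof (cases "x \<in> ?E1")
      case True
      have "(\<integral>\<^sup>+y. indicator ?E (?mg x y) \<partial>?M2)
          = (\<integral>\<^sup>+y. indicator {y \<in> space ?M2. ?mg x y \<in> ?E} y \<partial>?M2)"
        by (rule nn_integral_cong) (auto simp: indicator_def)
      also have "\<dots> = emeasure ?M2 {y \<in> space ?M2. ?mg x y \<in> ?E}"
        by (rule nn_integral_indicator) (auto simp: s2 sp2)
      also have "\<dots> \<ge> ennreal (1 / 2)"
        unfolding M2.emeasure_eq_measure by (rule ennreal_leI[OF half[OF True]])
      also have "ennreal (1 / 2) = ennreal (1 / 2) * indicator ?E1 x" using True by simp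
      finally show ?thesis .
    qed simp
  qed
  also have "(\<integral>\<^sup>+x. ennreal (1 / 2) * indicator ?E1 x \<partial>?M1) = ennreal (1 / 2) * emeasure ?M1 ?E1"
    by (rule nn_integral_cmult_indicator) (auto simp: s1 sp1)
  finally have "ennreal (1 / 2) * emeasure ?M1 ?E1 \<le> emeasure ?M ?E" .
  then have "ennreal (1 / 2 * measure ?M1 ?E1) \<le> ennreal (measure ?M ?E)"
    unfolding M1.emeasure_eq_measure M.emeasure_eq_measure by (subst ennreal_mult) auto
  then have "1 / 2 * measure ?M1 ?E1 \<le> measure ?M ?E" by (subst (asm) ennreal_le_iff) auto
  then show ?thesis by simp
qed

section \<open>Fat-shattering dimensions\<close>

lemma shatE:
  assumes "shat s A P" "Q \<subseteq> P"
  obtains f where "f \<in> A" "\<And>p. p \<in> Q \<Longrightarrow> snd p + s \<le> f (fst p)"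
    "\<And>p. p \<in> P \<Longrightarrow> p \<notin> Q \<Longrightarrow> f (fst p) \<le> snd p"
proof -
  obtain f where "f \<in> A" "\<forall>p\<in>Q. snd p + s \<le> f (fst p)" "\<forall>p\<in>P - Q. f (fst p) \<le> snd p"
    using assms(1)[unfolded shat_def case_prod_unfold, THEN spec, THEN mp, OF assms(2)]
    by (elim bexE conjE)
  then show ?thesis using that[of f] by simp
qed

lemma shatI:
  assumes "\<And>Q. Q \<subseteq> P \<Longrightarrow> \<exists>f\<in>A. (\<forall>p\<in>Q. snd p + s \<le> f (fst p)) \<and> (\<forall>p\<in>P - Q. f (fst p) \<le> snd p)"
  shows "shat s A P"
  unfolding shat_def case_prod_unfold by (intro allI impI assms)

text \<open>The map may move points and thresholds, provided that each member of \<open>A\<close>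
  has a counterpart in \<open>B\<close> meeting the transported demands. Injectivity comes for free:
  if \<open>p\<close> and \<open>q\<close> had the same image, the labelling that raises
  \<open>p\<close> only would put contradictory demands on one point.\<close>

lemma shat_image:
  assumes P: "shat s A P" and s: "s' > 0"
    and \<phi>: "\<And>f. f \<in> A \<Longrightarrow> \<exists>g\<in>B. \<forall>p\<in>P. (snd p + s \<le> f (fst p) \<longrightarrow> snd (\<phi> p) + s' \<le> g (fst (\<phi> p))) \<and>
                (f (fst p) \<le> snd p \<longrightarrow> g (fst (\<phi> p)) \<le> snd (\<phi> p))"
  shows "inj_on \<phi> P" and "shat s' B (\<phi> ` P)"
proof -
  have *: "\<exists>g\<in>B. (\<forall>p\<in>Q. snd (\<phi> p) + s' \<le> g (fst (\<phi> p))) \<and> (\<forall>p\<in>P - Q. g (fst (\<phi> p)) \<le> snd (\<phi> p))"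
    if Q: "Q \<subseteq> P" for Q
  proof -
    obtain f where f: "f \<in> A" "\<And>p. p \<in> Q \<Longrightarrow> snd p + s \<le> f (fst p)"
        "\<And>p. p \<in> P \<Longrightarrow> p \<notin> Q \<Longrightarrow> f (fst p) \<le> snd p"
      using shatE[OF P Q] by metis
    obtain g where g: "g \<in> B" "\<forall>p\<in>P. (snd p + s \<le> f (fst p) \<longrightarrow> snd (\<phi> p) + s' \<le> g (fst (\<phi> p))) \<and>
                (f (fst p) \<le> snd p \<longrightarrow> g (fst (\<phi> p)) \<le> snd (\<phi> p))"
      using \<phi>[OF f(1)] by (elim bexE)
    show ?thesis
    proof (intro bexI[OF _ g(1)] conjI ballI)
      show "snd (\<phi> p) + s' \<le> g (fst (\<phi> p))" if "p \<in> Q" for p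
        using g(2)[THEN bspec, OF subsetD[OF Q that]] f(2)[OF that] by simp
      show "g (fst (\<phi> p)) \<le> snd (\<phi> p)" if "p \<in> P - Q" for p
        using g(2)[THEN bspec, of p] f(3)[of p] that by simp
    qed
  qed
  show "inj_on \<phi> P"
  proof (rule inj_onI, rule ccontr)
    fix p q assume pq: "p \<in> P" "q \<in> P" "\<phi> p = \<phi> q" "p \<noteq> q"
    obtain g where "\<forall>p\<in>{p}. snd (\<phi> p) + s' \<le> g (fst (\<phi> p))" "\<forall>p\<in>P - {p}. g (fst (\<phi> p)) \<le> snd (\<phi> p)"
      using *[of "{p}"] pq by auto
    then have "snd (\<phi> p) + s' \<le> g (fst (\<phi> p))" "g (fst (\<phi> q)) \<le> snd (\<phi> q)" using pq by auto
    then show False using pq s by simp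
  qed
  show "shat s' B (\<phi> ` P)"
  proof (rule shatI)
    fix Q' assume Q': "Q' \<subseteq> \<phi> ` P"
    have "{p\<in>P. \<phi> p \<in> Q'} \<subseteq> P" by simp
    then obtain g where g: "g \<in> B" "\<forall>p\<in>{p\<in>P. \<phi> p \<in> Q'}. snd (\<phi> p) + s' \<le> g (fst (\<phi> p))"
        "\<forall>p\<in>P - {p\<in>P. \<phi> p \<in> Q'}. g (fst (\<phi> p)) \<le> snd (\<phi> p)"
      using *[of "{p\<in>P. \<phi> p \<in> Q'}"] by (elim meta_impE bexE conjE)
    show "\<exists>f\<in>B. (\<forall>p\<in>Q'. snd p + s' \<le> f (fst p)) \<and> (\<forall>p\<in>\<phi> ` P - Q'. f (fst p) \<le> snd p)"
    proof (intro bexI[OF _ g(1)] conjI ballI)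
      fix q assume q: "q \<in> Q'"
      then obtain p where "p \<in> P" "q = \<phi> p" using Q' by auto
      then show "snd q + s' \<le> g (fst q)" using g(2)[THEN bspec, of p] q by simp
    next
      fix q assume q: "q \<in> \<phi> ` P - Q'"
      then obtain p where "p \<in> P" "q = \<phi> p" by auto
      then show "g (fst q) \<le> snd q" using g(3)[THEN bspec, of p] q by simp
    qed
  qed
qed

text \<open>The threshold in \<open>shat\<close> is the lower edge of the gap, that in
  \<open>fatly_shatters\<close> its centre, hence the shift by \<open>\<gamma>\<close>. The
  enumeration is distinct, so a list of labels corresponds to a subset of \<open>P\<close>.\<close>

lemma fatly_shatters_of_shat:
  assumes P: "finite P" "shat (2 * \<gamma>) F P"
  obtains ps where "length ps = card P" "set ps = (\<lambda>(x, r). (x, r + \<gamma>)) ` P" "fatly_shatters F \<gamma> ps"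
proof -
  obtain qs where qs: "set qs = P" "distinct qs" using finite_distinct_list[OF P(1)] by blast
  let ?ps = "map (\<lambda>(x, r). (x, r + \<gamma>)) qs"
  have "fatly_shatters F \<gamma> ?ps"
    unfolding fatly_shatters_def
  proof (intro allI impI)
    fix b :: "bool list" assume "length b = length ?ps"
    define Q where "Q = {qs ! j | j. j < length qs \<and> b ! j}"
    have "Q \<subseteq> P" using qs(1) by (auto simp: Q_def)
    then obtain f where f: "f \<in> F" "\<And>p. p \<in> Q \<Longrightarrow> snd p + 2 * \<gamma> \<le> f (fst p)"
        "\<And>p. p \<in> P \<Longrightarrow> p \<notin> Q \<Longrightarrow> f (fst p) \<le> snd p"
      using shatE[OF P(2)] by metis
    have "qs ! j \<notin> Q" if "j < length qs" "\<not> b ! j" for j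
      using that nth_eq_iff_index_eq[OF qs(2)] by (auto simp: Q_def)
    moreover have "qs ! j \<in> P" if "j < length qs" for j using that qs(1) by auto
    moreover have "qs ! j \<in> Q" if "j < length qs" "b ! j" for j using that by (auto simp: Q_def)
    ultimately show "\<exists>f\<in>F. \<forall>j<length ?ps. (b ! j \<longrightarrow> snd (?ps ! j) + \<gamma> \<le> f (fst (?ps ! j))) \<and>
        (\<not> b ! j \<longrightarrow> f (fst (?ps ! j)) \<le> snd (?ps ! j) - \<gamma>)"
      using f(2)[of "qs ! j" for j] f(3)[of "qs ! j" for j]
      by (intro bexI[OF _ f(1)]) (simp add: case_prod_unfold algebra_simps)
  qed
  moreover have "length ?ps = card P" using distinct_card[OF qs(2)] qs(1) by simp
  ultimately show ?thesis using that[of ?ps] qs(1) by simp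
qed

text \<open>A repeated entry could be labelled in two ways at once, which a positive margin forbids.
  A shattered list is therefore as long as its set of entries, and lengths become
  cardinalities.\<close>

lemma shat_of_fatly_shatters:
  assumes ps: "fatly_shatters F \<gamma> ps" and \<gamma>: "\<gamma> > 0"
  shows "distinct ps" and "shat (2 * \<gamma>) F ((\<lambda>(x, r). (x, r - \<gamma>)) ` set ps)"
proof -
  show "distinct ps"
    unfolding distinct_conv_nth
  proof (intro allI impI notI)
    fix i j assume ij: "i < length ps" "j < length ps" "i \<noteq> j" "ps ! i = ps ! j"
    define b where "b = map (\<lambda>l. l = i) [0..<length ps]"
    have "length b = length ps" by (simp add: b_def)
    then obtain f where f: "\<forall>l<length ps. (b ! l \<longrightarrow> snd (ps ! l) + \<gamma> \<le> f (fst (ps ! l))) \<and>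
        (\<not> b ! l \<longrightarrow> f (fst (ps ! l)) \<le> snd (ps ! l) - \<gamma>)"
      using ps unfolding fatly_shatters_def by blast
    have "b ! i" "\<not> b ! j" using ij by (auto simp: b_def)
    then have "snd (ps ! i) + \<gamma> \<le> f (fst (ps ! i))" "f (fst (ps ! j)) \<le> snd (ps ! j) - \<gamma>"
      using f ij by blast+
    then show False using ij \<gamma> by simp
  qed
  let ?P = "(\<lambda>p. (fst p, snd p - \<gamma>)) ` set ps"
  have "shat (2 * \<gamma>) F ?P"
  proof (rule shatI)
    fix Q assume Q: "Q \<subseteq> ?P"
    define b where "b = map (\<lambda>p. (fst p, snd p - \<gamma>) \<in> Q) ps"
    have "length b = length ps" by (simp add: b_def)
    then obtain f where f: "f \<in> F" "\<And>l. l < length ps \<Longrightarrow>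
        (b ! l \<longrightarrow> snd (ps ! l) + \<gamma> \<le> f (fst (ps ! l))) \<and>
        (\<not> b ! l \<longrightarrow> f (fst (ps ! l)) \<le> snd (ps ! l) - \<gamma>)"
      using ps unfolding fatly_shatters_def by metis
    have *: "if (fst p, snd p - \<gamma>) \<in> Q then snd p + \<gamma> \<le> f (fst p) else f (fst p) \<le> snd p - \<gamma>"
      if p: "p \<in> set ps" for p
    proof -
      obtain l where l: "l < length ps" "ps ! l = p" using p by (metis in_set_conv_nth)
      then have "b ! l \<longleftrightarrow> (fst p, snd p - \<gamma>) \<in> Q" by (simp add: b_def)
      then show ?thesis using f(2)[OF l(1)] l(2) by simp
    qed
    show "\<exists>f\<in>F. (\<forall>p\<in>Q. snd p + 2 * \<gamma> \<le> f (fst p)) \<and> (\<forall>p\<in>?P - Q. f (fst p) \<le> snd p)"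
    proof (intro bexI[OF _ f(1)] conjI ballI)
      fix q assume q: "q \<in> Q"
      then obtain p where "p \<in> set ps" "q = (fst p, snd p - \<gamma>)" using Q by auto
      then show "snd q + 2 * \<gamma> \<le> f (fst q)" using *[of p] q by simp
    next
      fix q assume q: "q \<in> ?P - Q"
      then obtain p where "p \<in> set ps" "q = (fst p, snd p - \<gamma>)" by auto
      then show "f (fst q) \<le> snd q" using *[of p] q by simp
    qed
  qed
  then show "shat (2 * \<gamma>) F ((\<lambda>(x, r). (x, r - \<gamma>)) ` set ps)" by (simp add: case_prod_unfold)
qed

lemma card_le_fat:
  assumes "finite P" "shat (2 * \<gamma>) F P" "\<And>x r. (x, r) \<in> P \<Longrightarrow> x \<in> X \<and> r + \<gamma> \<in> {0..1}"
  shows "enat (card P) \<le> fat X F \<gamma>"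
proof -
  obtain ps where ps: "length ps = card P" "set ps = (\<lambda>(x, r). (x, r + \<gamma>)) ` P" "fatly_shatters F \<gamma> ps"
    by (rule fatly_shatters_of_shat[OF assms(1,2)])
  have "set ps \<subseteq> X \<times> {0..1}" using ps(2) assms(3) by auto
  then show ?thesis unfolding fat_def ps(1)[symmetric] using ps(3) by (intro Sup_upper) blast
qed

lemma card_le_fatV:
  assumes "finite P" "shat (2 * \<gamma>) F P" "\<And>p. p \<in> P \<Longrightarrow> fst p \<in> X \<and> snd p + \<gamma> = r" "r \<in> {0..1}"
  shows "enat (card P) \<le> fatV X F \<gamma>"
proof -
  obtain ps where ps: "length ps = card P" "set ps = (\<lambda>(x, r). (x, r + \<gamma>)) ` P" "fatly_shatters F \<gamma> ps"
    by (rule fatly_shatters_of_shat[OF assms(1,2)])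
  have r: "\<forall>p\<in>set ps. snd p = r" using ps(2) assms(3) by fastforce
  have "set ps \<subseteq> X \<times> {0..1}" using ps(2) assms(3,4) by fastforce
  then show ?thesis unfolding fatV_def ps(1)[symmetric] using ps(3) r assms(4) by (intro Sup_upper) blast
qed

text \<open>Round every threshold down to the grid, which costs at most \<open>\<eta>\<close> of the
  margin. Entries rounded to the same grid value are then shattered with one common threshold, so
  each grid value accounts for at most \<open>d\<close> entries.\<close>

lemma fat_le_fatV:
  assumes \<gamma>: "\<gamma> > 0" and \<eta>: "\<eta> > 0" and d: "fatV X F \<gamma> \<le> enat d"
  shows "fat X F (\<gamma> + \<eta>) \<le> enat (card (grid \<eta>) * d)"
  unfolding fat_def
proof (rule Sup_least, clarify)
  fix ps assume ps: "set ps \<subseteq> X \<times> {0..1}" "fatly_shatters F (\<gamma> + \<eta>) ps"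
  define P where "P = (\<lambda>(x, r). (x, r - (\<gamma> + \<eta>))) ` set ps"
  \<comment> \<open>It is the centre of the gap that is rounded, not the lower edge stored in
    \<open>P\<close>; the centre is the quantity known to lie in \<open>[0, 1]\<close>.\<close>
  define rd where "rd r = \<eta> * real (nat \<lfloor>(r + (\<gamma> + \<eta>)) / \<eta>\<rfloor>)" for r
  have sh: "shat (2 * (\<gamma> + \<eta>)) F P" and dist: "distinct ps"
    using shat_of_fatly_shatters[OF ps(2)] \<gamma> \<eta> by (auto simp: P_def)
  have fin: "finite P" by (simp add: P_def)
  have len: "length ps = card P"
    unfolding P_def using distinct_card[OF dist] by (subst card_image) (auto simp: inj_on_def)
  have PX: "fst p \<in> X \<and> 0 \<le> snd p + (\<gamma> + \<eta>) \<and> snd p + (\<gamma> + \<eta>) \<le> 1" if "p \<in> P" for p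
    using that ps(1) by (auto simp: P_def)
  have rd: "rd (snd p) \<le> snd p + (\<gamma> + \<eta>)" "snd p + (\<gamma> + \<eta>) \<le> rd (snd p) + \<eta>" "rd (snd p) \<in> grid \<eta>"
    if p: "p \<in> P" for p
  proof -
    let ?y = "(snd p + (\<gamma> + \<eta>)) / \<eta>"
    have "?y \<ge> 0" using PX[OF p] \<eta> by simp
    then have "real (nat \<lfloor>?y\<rfloor>) \<le> ?y" "?y \<le> real (nat \<lfloor>?y\<rfloor>) + 1" by (auto simp: of_nat_nat)
    then show le: "rd (snd p) \<le> snd p + (\<gamma> + \<eta>)" "snd p + (\<gamma> + \<eta>) \<le> rd (snd p) + \<eta>"
      unfolding rd_def using \<eta> by (auto simp: field_simps)
    show "rd (snd p) \<in> grid \<eta>"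
      unfolding grid_def rd_def using le(1) PX[OF p] by (intro imageI CollectI) (simp add: rd_def)
  qed
  have "P = (\<Union>r\<in>grid \<eta>. {p\<in>P. rd (snd p) = r})" using rd(3) by auto
  then have "card P \<le> (\<Sum>r\<in>grid \<eta>. card {p\<in>P. rd (snd p) = r})"
    using card_UN_le[OF finite_grid[OF \<eta>], of "\<lambda>r. {p\<in>P. rd (snd p) = r}"] by simp
  also have "\<dots> \<le> (\<Sum>r\<in>grid \<eta>. d)"
  proof (rule sum_mono)
    fix r assume r: "r \<in> grid \<eta>"
    let ?P = "{p\<in>P. rd (snd p) = r}" and ?\<phi> = "\<lambda>p::'a \<times> real. (fst p, r - \<gamma>)"
    have "shat (2 * (\<gamma> + \<eta>)) F ?P"
    proof (rule shatI)
      fix Q assume Q: "Q \<subseteq> ?P"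
      then have "Q \<subseteq> P" by auto
      then obtain f where "f \<in> F" "\<And>p. p \<in> Q \<Longrightarrow> snd p + 2 * (\<gamma> + \<eta>) \<le> f (fst p)"
          "\<And>p. p \<in> P \<Longrightarrow> p \<notin> Q \<Longrightarrow> f (fst p) \<le> snd p"
        using shatE[OF sh] by metis
      then show "\<exists>f\<in>F. (\<forall>p\<in>Q. snd p + 2 * (\<gamma> + \<eta>) \<le> f (fst p)) \<and> (\<forall>p\<in>?P - Q. f (fst p) \<le> snd p)"
        by (intro bexI[of _ f]) auto
    qed
    moreover have "\<exists>g\<in>F. \<forall>p\<in>?P. (snd p + 2 * (\<gamma> + \<eta>) \<le> f (fst p) \<longrightarrow> snd (?\<phi> p) + 2 * \<gamma> \<le> g (fst (?\<phi> p))) \<and>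
          (f (fst p) \<le> snd p \<longrightarrow> g (fst (?\<phi> p)) \<le> snd (?\<phi> p))" if f: "f \<in> F" for f
    proof (intro bexI[OF _ f] ballI)
      fix p assume "p \<in> ?P"
      then show "(snd p + 2 * (\<gamma> + \<eta>) \<le> f (fst p) \<longrightarrow> snd (?\<phi> p) + 2 * \<gamma> \<le> f (fst (?\<phi> p))) \<and>
          (f (fst p) \<le> snd p \<longrightarrow> f (fst (?\<phi> p)) \<le> snd (?\<phi> p))"
        using rd(1,2)[of p] by auto
    qed
    moreover have "2 * \<gamma> > 0" using \<gamma> by simp
    ultimately have im: "inj_on ?\<phi> ?P" "shat (2 * \<gamma>) F (?\<phi> ` ?P)"
      using shat_image[of "2 * (\<gamma> + \<eta>)" F ?P "2 * \<gamma>" F ?\<phi>] by blast+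
    have "enat (card (?\<phi> ` ?P)) \<le> fatV X F \<gamma>"
      by (rule card_le_fatV[OF _ im(2), where r = r])
        (use fin PX r grid_subset[OF \<eta>] in auto)
    from order_trans[OF this d] show "card ?P \<le> d" by (simp only: card_image[OF im(1)] enat_ord_simps)
  qed
  also have "\<dots> = card (grid \<eta>) * d" by simp
  finally show "enat (length ps) \<le> enat (card (grid \<eta>) * d)" by (simp add: len)
qed

text \<open>The size bound provides a separated subset of greatest size. It is a net, since a
  function farther than \<open>c\<close> from all its members could be added to it.\<close>

lemma exists_maximal_separated:
  fixes G :: "('i \<Rightarrow> real) set" and c N :: real
  assumes bound: "\<And>A. finite A \<Longrightarrow> A \<subseteq> G \<Longrightarrow>
      (\<And>f g. f \<in> A \<Longrightarrow> g \<in> A \<Longrightarrow> f \<noteq> g \<Longrightarrow> c \<le> (\<Sum>x\<in>I. \<bar>f x - g x\<bar>)) \<Longrightarrow> real (card A) \<le> N"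
    and c: "c \<ge> 0"
  shows "\<exists>A. finite A \<and> A \<subseteq> G \<and> card A \<le> N \<and> (\<forall>f\<in>G. \<exists>g\<in>A. (\<Sum>x\<in>I. \<bar>f x - g x\<bar>) \<le> c)"
proof -
  define Sep where "Sep A \<longleftrightarrow> finite A \<and> A \<subseteq> G \<and>
    (\<forall>f\<in>A. \<forall>g\<in>A. f \<noteq> g \<longrightarrow> c \<le> (\<Sum>x\<in>I. \<bar>f x - g x\<bar>))" for A
  have le: "card A \<le> nat \<lfloor>N\<rfloor>" if "Sep A" for A
    using that unfolding Sep_def by (intro le_nat_floor bound) auto
  have "Sep {}" by (simp add: Sep_def)
  then obtain A where A: "Sep A" "\<And>B. Sep B \<Longrightarrow> card B \<le> card A"
    using ex_has_greatest_nat[of Sep "{}" card "Suc (nat \<lfloor>N\<rfloor>)"] le by (metis le_imp_less_Suc)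
  have "\<exists>g\<in>A. (\<Sum>x\<in>I. \<bar>f x - g x\<bar>) \<le> c" if f: "f \<in> G" for f
  proof (rule ccontr)
    assume "\<not> ?thesis"
    then have far: "c < (\<Sum>x\<in>I. \<bar>f x - g x\<bar>)" if "g \<in> A" for g using that by (auto simp: not_le)
    then have "f \<notin> A" using c by fastforce
    moreover have "(\<Sum>x\<in>I. \<bar>g x - f x\<bar>) = (\<Sum>x\<in>I. \<bar>f x - g x\<bar>)" for g
      by (rule sum.cong) (auto simp: abs_minus_commute)
    then have "Sep (insert f A)"
      using far[THEN less_imp_le] A(1) f unfolding Sep_def by (simp add: ball_Un)
    ultimately show False using A(2)[of "insert f A"] A(1) by (simp add: Sep_def)
  qed
  moreover have "card A \<le> N" using A(1) unfolding Sep_def by (intro bound) auto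
  moreover have "finite A" "A \<subseteq> G" using A(1) by (simp_all add: Sep_def)
  ultimately show ?thesis by (intro exI[of _ A]) simp
qed

section \<open>Sample complexity\<close>

text \<open>A maximal separated set of patterns on the sample is a net. Its \<open>1 / k\<close>-th
  power is at most its number of shattered sets; these have at most \<open>d\<close> elements, so
  the counting bound applies, and the \<open>k\<close>-th power undoes the root.\<close>

lemma exists_net_of_fat:
  fixes F :: "('a \<Rightarrow> real) set" and z :: "'i \<Rightarrow> 'a" and k d :: nat and \<gamma> \<eta> \<rho> N0 v :: real
  assumes F: "F \<subseteq> X \<rightarrow> {0..1}" and d: "fat X F \<gamma> \<le> enat d"
    and I: "finite I" "I \<noteq> {}" and z: "\<And>i. i \<in> I \<Longrightarrow> z i \<in> X"
    and \<gamma>: "\<gamma> > 0" and \<eta>: "\<eta> > 0" and k: "k \<ge> 2"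
    and N0: "N0 powr (1 / k) \<le> 2" and \<rho>: "2 * \<gamma> + \<eta> < \<rho>"
    and gap: "\<And>N. N0 < N \<Longrightarrow> (2 * \<gamma> + \<eta>) * (1 + 8 / 2 ^ k) < \<rho> * (1 - 1 / N)"
    and v: "0 < v" "v \<le> 1"
  shows "\<exists>G. finite G \<and> card G \<le> (exp (v * (card I * (1 / \<eta> + 1))) / v ^ d) ^ k \<and>
      (\<forall>g\<in>G. \<forall>j\<in>I. g j \<in> {0..1::real}) \<and> (\<forall>f\<in>F. \<exists>g\<in>G. (\<Sum>j\<in>I. \<bar>f (z j) - g j\<bar>) \<le> \<rho> * card I)"
proof -
  define G0 where "G0 = (\<lambda>f j. f (z j)) ` F"
  define b where "b = exp (v * (card I * (1 / \<eta> + 1))) / v ^ d"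
  let ?U = "I \<times> grid \<eta>" and ?s = "2 * \<gamma>"
  have s: "?s > 0" using \<gamma> by simp
  have U: "finite ?U" using I finite_grid[OF \<eta>] by simp
  have F01: "f x \<in> {0..1}" if "f \<in> F" "x \<in> X" for f x using F that by blast
  have G01: "g j \<in> {0..1}" if "g \<in> G0" "j \<in> I" for g j
    using that z F01 by (auto simp: G0_def)
  \<comment> \<open>Indices are carried to sample points. Even if \<open>z\<close> repeats points,
    \<open>shat_image\<close> makes this injective on \<open>P\<close>, so no elements are
    lost.\<close>
  have dim: "card P \<le> d" if A: "A \<subseteq> G0" and P: "P \<in> shats ?s A ?U" for A P
  proof -
    let ?\<phi> = "\<lambda>p::'i \<times> real. (z (fst p), snd p)"
    have sh: "shat ?s A P" and PU: "P \<subseteq> ?U" using P by (auto simp: shats_def)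
    have "\<exists>f\<in>F. \<forall>p\<in>P. (snd p + ?s \<le> g (fst p) \<longrightarrow> snd (?\<phi> p) + ?s \<le> f (fst (?\<phi> p))) \<and>
        (g (fst p) \<le> snd p \<longrightarrow> f (fst (?\<phi> p)) \<le> snd (?\<phi> p))" if "g \<in> A" for g
    proof -
      have "g \<in> G0" using that A by auto
      then obtain f where "f \<in> F" "g = (\<lambda>j. f (z j))" by (auto simp: G0_def)
      then show ?thesis by (intro bexI[of _ f]) auto
    qed
    note im = shat_image[OF sh s this]
    have "enat (card (?\<phi> ` P)) \<le> fat X F \<gamma>"
    proof (rule card_le_fat[OF _ im(2)])
      show "finite (?\<phi> ` P)" using PU U by (auto intro: finite_subset)
      fix x r assume "(x, r) \<in> ?\<phi> ` P"
      then obtain j where j: "(j, r) \<in> P" "x = z j" by auto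
      then have jr: "j \<in> I" "r \<in> grid \<eta>" using PU by auto
      then have x: "x \<in> X" using z j by simp
      \<comment> \<open>A function above all gaps of \<open>P\<close> shows that the upper edge
        \<open>r + 2 * \<gamma>\<close> is at most 1, so the centre \<open>r + \<gamma>\<close> is
        an admissible threshold.\<close>
      obtain f where f: "f \<in> F" "\<And>p. p \<in> ?\<phi> ` P \<Longrightarrow> snd p + ?s \<le> f (fst p)"
        using shatE[OF im(2) subset_refl] by metis
      have "r + ?s \<le> f x" using f(2)[OF \<open>(x, r) \<in> ?\<phi> ` P\<close>] by simp
      moreover have "r \<ge> 0" using jr grid_subset[OF \<eta>] by auto
      moreover have "f x \<le> 1" using F01[OF f(1) x] by simp
      ultimately show "x \<in> X \<and> r + \<gamma> \<in> {0..1}" using x \<gamma> by simp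
    qed
    from order_trans[OF this d] show ?thesis by (simp only: card_image[OF im(1)] enat_ord_simps)
  qed
  have bound: "real (card A) \<le> b ^ k" if A: "finite A" "A \<subseteq> G0"
    and sep: "\<And>f g. f \<in> A \<Longrightarrow> g \<in> A \<Longrightarrow> f \<noteq> g \<Longrightarrow> \<rho> * card I \<le> (\<Sum>x\<in>I. \<bar>f x - g x\<bar>)" for A
  proof -
    have "card A powr (1 / k) \<le> card (shats ?s A ?U)"
      by (rule packing_le_shats[OF I \<eta> s k N0 \<rho> gap A(1) _ sep]) (use G01 A(2) in blast)+
    also have "\<dots> \<le> exp (v * card ?U) / v ^ d"
      by (rule card_bounded_subsets_le[OF U]) (use dim[OF A(2)] v in \<open>auto simp: shats_def\<close>)
    also have "\<dots> \<le> b"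
      unfolding b_def using card_grid_le[OF \<eta>] v
      by (intro divide_right_mono exp_le_cancel_iff[THEN iffD2] mult_left_mono)
        (auto simp: card_cartesian_product intro!: mult_left_mono)
    finally have "(card A powr (1 / k)) ^ k \<le> b ^ k" by (intro power_mono) auto
    moreover have "(card A powr (1 / k)) ^ k = card A"
    proof (cases "card A = 0")
      case False
      then show ?thesis using k by (subst powr_realpow[symmetric]) (auto simp: powr_powr)
    qed (use k in auto)
    ultimately show ?thesis by simp
  qed
  have "0 \<le> \<rho> * card I" using \<rho> \<gamma> \<eta> by simp
  then have "\<exists>G. finite G \<and> G \<subseteq> G0 \<and> card G \<le> b ^ k \<and>
      (\<forall>g\<in>G0. \<exists>h\<in>G. (\<Sum>x\<in>I. \<bar>g x - h x\<bar>) \<le> \<rho> * card I)"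
    by (intro exists_maximal_separated bound)
  then obtain G where G: "finite G" "G \<subseteq> G0" "card G \<le> b ^ k"
      "\<And>g. g \<in> G0 \<Longrightarrow> \<exists>h\<in>G. (\<Sum>x\<in>I. \<bar>g x - h x\<bar>) \<le> \<rho> * card I"
    by (elim exE conjE) simp
  show ?thesis
    unfolding b_def[symmetric]
  proof (intro exI[of _ G] conjI ballI)
    show "g j \<in> {0..1}" if "g \<in> G" "j \<in> I" for g j using G01 G(2) that by blast
    show "\<exists>g\<in>G. (\<Sum>j\<in>I. \<bar>f (z j) - g j\<bar>) \<le> \<rho> * card I" if "f \<in> F" for f
      using G(4)[of "\<lambda>j. f (z j)"] that by (auto simp: G0_def)
  qed (use G in auto)
qed

text \<open>The number \<open>k\<close> is chosen with \<open>16 / \<kappa> < 2 ^ k\<close>. Then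
  \<open>8 / 2 ^ k\<close> and \<open>1 / N\<close> are both below \<open>\<kappa> / 2\<close>, and
  each is multiplied by at most \<open>1 / 2\<close>; together they lose less than the difference
  \<open>\<kappa> / 2\<close> of the two leading factors. Scaled by \<open>\<epsilon>\<close>, these
  factors become \<open>2 * \<gamma> + \<eta>\<close> and \<open>\<rho>\<close>.\<close>

lemma exists_rate:
  fixes \<kappa> :: real
  assumes \<kappa>: "0 < \<kappa>" "\<kappa> < 1 / 4"
  obtains k :: nat where "k \<ge> 2" "(2 / \<kappa>) powr (1 / k) \<le> 2"
    "\<And>N. 2 / \<kappa> < N \<Longrightarrow> (1 / 2 - 3 * \<kappa> / 2) * (1 + 8 / 2 ^ k) < (1 / 2 - \<kappa>) * (1 - 1 / N)"
proof -
  obtain k :: nat where k: "16 / \<kappa> < 2 ^ k" using real_arch_pow[of 2 "16 / \<kappa>"] by auto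
  have big: "64 < 16 / \<kappa>" using \<kappa> by (simp add: field_simps)
  have "\<not> k < 2"
  proof
    assume "k < 2"
    then have "(2::real) ^ k \<le> 2 ^ 1" by (intro power_increasing) auto
    then show False using k big by simp
  qed
  then have k2: "k \<ge> 2" by simp
  have "(2 / \<kappa>) powr (1 / k) \<le> (2 ^ k) powr (1 / k)"
  proof (rule powr_mono2)
    have "2 / \<kappa> \<le> 16 / \<kappa>" using \<kappa> by (simp add: divide_right_mono)
    then show "2 / \<kappa> \<le> 2 ^ k" using k by simp
  qed (use \<kappa> in auto)
  also have "\<dots> = 2" using k2 by (simp add: powr_powr flip: powr_realpow)
  finally have p: "(2 / \<kappa>) powr (1 / k) \<le> 2" .
  have t: "8 / 2 ^ k < \<kappa> / 2" using k \<kappa> by (simp add: field_simps)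
  have "(1 / 2 - 3 * \<kappa> / 2) * (1 + 8 / 2 ^ k) < (1 / 2 - \<kappa>) * (1 - 1 / N)" if N: "2 / \<kappa> < N" for N
  proof -
    have "0 < N" using N \<kappa> by (meson divide_pos_pos less_trans zero_less_numeral)
    then have n: "1 / N < \<kappa> / 2" "0 < 1 / N" using N \<kappa> by (simp_all add: field_simps)
    have "(1 / 2 - 3 * \<kappa> / 2) * (8 / 2 ^ k) \<le> 1 / 2 * (8 / 2 ^ k)"
      using \<kappa> by (intro mult_right_mono) auto
    moreover have "(1 / 2 - \<kappa>) * (1 / N) \<le> 1 / 2 * (1 / N)"
      by (intro mult_right_mono) (use \<kappa> n in linarith)+
    moreover have "(1 / 2 - 3 * \<kappa> / 2) * (1 + 8 / 2 ^ k)
        = (1 / 2 - 3 * \<kappa> / 2) + (1 / 2 - 3 * \<kappa> / 2) * (8 / 2 ^ k)"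
      by (simp only: distrib_left mult_1_right)
    moreover have "(1 / 2 - \<kappa>) * (1 - 1 / N) = (1 / 2 - \<kappa>) - (1 / 2 - \<kappa>) * (1 / N)"
      by (simp only: right_diff_distrib mult_1_right)
    ultimately show ?thesis using t n by linarith
  qed
  then show ?thesis using that k2 p by blast
qed

text \<open>The deviation \<open>\<epsilon>\<close> is spent as \<open>\<kappa> * \<epsilon>\<close>
  on the second half of the sample, \<open>\<kappa> * \<epsilon>\<close> on the random signs, and
  twice the net radius \<open>(1 / 2 - \<kappa>) * \<epsilon>\<close> on the approximation.\<close>

lemma GC_ok_of_sample_size:
  fixes \<kappa> :: real
  assumes \<kappa>: "0 < \<kappa>" "\<kappa> < 1 / 4"
  obtains C where "C \<ge> 1" "\<And>(X :: 'a set) F \<epsilon> \<delta> d m. countable X \<Longrightarrow> F \<subseteq> X \<rightarrow> {0..1} \<Longrightarrow>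
      0 < \<epsilon> \<Longrightarrow> \<epsilon> \<le> 1 / 2 \<Longrightarrow> 0 < \<delta> \<Longrightarrow> \<delta> \<le> 1 / 2 \<Longrightarrow> fat X F ((1 / 4 - \<kappa>) * \<epsilon>) \<le> enat d \<Longrightarrow>
      C / \<epsilon>\<^sup>2 * (d * ln (1 / \<epsilon>) + ln (1 / \<delta>)) \<le> real m \<Longrightarrow> GC_ok X F \<epsilon> \<delta> m"
proof -
  obtain k :: nat where k: "k \<ge> 2" "(2 / \<kappa>) powr (1 / k) \<le> 2"
    "\<And>N. 2 / \<kappa> < N \<Longrightarrow> (1 / 2 - 3 * \<kappa> / 2) * (1 + 8 / 2 ^ k) < (1 / 2 - \<kappa>) * (1 - 1 / N)"
    using exists_rate[OF \<kappa>] by blast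
  \<comment> \<open>With \<open>v = \<epsilon> ^ 3 / w\<close>, this value makes the bound
    \<open>k * (v * ((2 * m) * (2 / \<eta>)))\<close> exactly \<open>e / 8\<close>.\<close>
  define w where "w = 64 * k / \<kappa> ^ 3"
  \<comment> \<open>Chosen so that \<open>k * ln (1 / v) <= c * L\<close>: here
    \<open>ln (1 / v) = ln w + 3 * L\<close>, and \<open>ln w\<close> is absorbed using
    \<open>L >= ln 2\<close>.\<close>
  define c where "c = k * (ln w / ln 2 + 3)"
  have \<kappa>3: "\<kappa> ^ 3 \<le> 1" using \<kappa> by (intro power_le_one) auto
  have w: "w \<ge> 64 * k" unfolding w_def using \<kappa> \<kappa>3 k(1) by (simp add: pos_le_divide_eq mult_left_le)
  then have w1: "w \<ge> 1" using k(1) by linarith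
  then have lnw: "ln w \<ge> 0" by simp
  have "1 * 3 \<le> k * (ln w / ln 2 + 3)" using k(1) lnw by (intro mult_mono) auto
  then have c: "c \<ge> 3" by (simp add: c_def)
  \<comment> \<open>The factor 4 reserves only a quarter of \<open>e\<close> for
    \<open>c * (d * L + l)\<close>.\<close>
  define C where "C = 4 * c / \<kappa>\<^sup>2"
  have \<kappa>2: "\<kappa>\<^sup>2 \<le> 1" using \<kappa> by (intro power_le_one) auto
  then have "C \<ge> 4 * c" unfolding C_def using \<kappa> c by (simp add: pos_le_divide_eq mult_left_le)
  then have C1: "C \<ge> 1" using c by simp
  have "GC_ok X F \<epsilon> \<delta> m"
    if X: "countable X" and F: "F \<subseteq> X \<rightarrow> {0..1}" and \<epsilon>: "0 < \<epsilon>" "\<epsilon> \<le> 1 / 2" and \<delta>: "0 < \<delta>" "\<delta> \<le> 1 / 2"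
      and d: "fat X F ((1 / 4 - \<kappa>) * \<epsilon>) \<le> enat d"
      and m: "C / \<epsilon>\<^sup>2 * (d * ln (1 / \<epsilon>) + ln (1 / \<delta>)) \<le> real m"
    for X :: "'a set" and F \<epsilon> \<delta> d m
    unfolding GC_ok_def
  proof (intro allI impI, elim conjE)
    fix D assume D: "prob_space D" "sets D = Pow X"
    define L where "L = ln (1 / \<epsilon>)"
    define l where "l = ln (1 / \<delta>)"
    have "ln 2 \<le> L" unfolding L_def using \<epsilon> by (subst ln_le_cancel_iff) (auto simp: field_simps)
    moreover have "ln 2 \<le> l" unfolding l_def using \<delta> by (subst ln_le_cancel_iff) (auto simp: field_simps)
    moreover have "ln 2 > (0::real)" by simp
    ultimately have L: "ln 2 \<le> L" "L > 0" and l: "ln 2 \<le> l" "l > 0" by linarith+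
    define e where "e = m * (\<kappa> * \<epsilon>)\<^sup>2"
    have "c * (d * L + l) = C / \<epsilon>\<^sup>2 * (d * L + l) * (\<kappa> * \<epsilon>)\<^sup>2 / 4"
      using \<kappa> \<epsilon> by (simp add: C_def power_mult_distrib)
    also have "\<dots> \<le> m * (\<kappa> * \<epsilon>)\<^sup>2 / 4"
      using m by (intro divide_right_mono mult_right_mono) (auto simp: L_def l_def)
    finally have e: "c * d * L + c * l \<le> e / 4" by (simp add: e_def algebra_simps)
    have "3 * l \<le> c * l" using c l by (intro mult_right_mono) auto
    moreover have "0 \<le> c * d * L" using c L by simp
    ultimately have e3: "3 * l \<le> e / 4" using e by linarith
    have mpos: "m > 0"
    proof (rule ccontr)
      assume "\<not> m > 0"
      then show False using e3 l by (simp add: e_def)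
    qed
    define v where "v = \<epsilon> ^ 3 / w"
    have \<epsilon>3: "\<epsilon> ^ 3 \<le> 1" "\<epsilon> ^ 3 > 0" using \<epsilon> by (auto intro!: power_le_one)
    have v: "0 < v" "v \<le> 1" using \<epsilon>3 w1 by (auto simp: v_def field_simps)
    have lnv: "ln (1 / v) = ln w + 3 * L"
      using \<epsilon> w1 by (simp add: v_def L_def ln_div ln_realpow)
    have "ln w * ln 2 \<le> ln w * L" using L lnw by (intro mult_left_mono)
    then have "ln w \<le> ln w / ln 2 * L" by (simp add: field_simps)
    then have "k * ln (1 / v) \<le> k * ((ln w / ln 2 + 3) * L)"
      unfolding lnv by (intro mult_left_mono) (auto simp: algebra_simps)
    then have "k * ln (1 / v) \<le> c * L" by (simp add: c_def)
    then have "d * (k * ln (1 / v)) \<le> d * (c * L)" by (rule mult_left_mono) simp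
    then have kdv: "k * d * ln (1 / v) \<le> c * d * L" by (simp add: mult_ac)
    define \<eta> where "\<eta> = \<kappa> * \<epsilon> / 2"
    define \<rho> where "\<rho> = (1 / 2 - \<kappa>) * \<epsilon>"
    define \<gamma> where "\<gamma> = (1 / 4 - \<kappa>) * \<epsilon>"
    define t where "t = \<kappa> * \<epsilon>"
    define N where "N = (exp (v * ((2 * m) * (1 / \<eta> + 1))) / v ^ d) ^ k"
    have pos: "\<eta> > 0" "\<gamma> > 0" "t > 0" using \<kappa> \<epsilon> by (auto simp: \<eta>_def \<gamma>_def t_def)
    have gs: "2 * \<gamma> + \<eta> = (1 / 2 - 3 * \<kappa> / 2) * \<epsilon>" by (simp add: \<gamma>_def \<eta>_def algebra_simps)
    have \<rho>: "2 * \<gamma> + \<eta> < \<rho>"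
      unfolding gs \<rho>_def using \<kappa> \<epsilon> by (intro mult_strict_right_mono) auto
    have gap: "(2 * \<gamma> + \<eta>) * (1 + 8 / 2 ^ k) < \<rho> * (1 - 1 / M)" if "2 / \<kappa> < M" for M
      using mult_strict_right_mono[OF k(3)[OF that] \<epsilon>(1)] unfolding gs \<rho>_def by (simp add: mult_ac)
    have "\<eta> \<le> 1" using mult_mono[of \<kappa> 1 \<epsilon> 1] \<kappa> \<epsilon> by (simp add: \<eta>_def)
    then have "1 / \<eta> + 1 \<le> 2 / \<eta>" using pos by (simp add: field_simps)
    then have "k * (v * ((2 * m) * (1 / \<eta> + 1))) \<le> k * (v * ((2 * m) * (2 / \<eta>)))"
      using v by (intro mult_left_mono) auto
    also have "\<dots> = e / 8"
      using \<kappa> \<epsilon> k(1) by (simp add: v_def w_def \<eta>_def e_def field_simps power2_eq_square power3_eq_cube)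
    finally have expo: "k * (v * ((2 * m) * (1 / \<eta> + 1))) \<le> e / 8" .
    have Npos: "N > 0" using v by (simp add: N_def)
    have "ln N = k * (v * ((2 * m) * (1 / \<eta> + 1)) + d * ln (1 / v))"
      using v by (simp add: N_def ln_realpow ln_div)
    then have "ln N = k * (v * ((2 * m) * (1 / \<eta> + 1))) + k * d * ln (1 / v)"
      by (simp only: distrib_left mult.assoc of_nat_mult)
    then have lnN: "ln N \<le> e / 8 + c * d * L" using expo kdv by linarith
    have small: "2 * exp (- 2 * m * t\<^sup>2) \<le> 1 / 2"
    proof -
      have "exp (- 2 * m * t\<^sup>2) \<le> exp (- (ln 2 + ln 2))"
        using e3 l by (simp add: t_def e_def)
      also have "\<dots> = 1 / 4" unfolding exp_minus exp_add by simp
      finally show ?thesis by simp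
    qed
    have "measure (PiM {..<m} (\<lambda>_. D)) {x \<in> space (PiM {..<m} (\<lambda>_. D)).
        \<exists>f\<in>F. \<bar>(1 / m) * (\<Sum>i<m. f (x i)) - (\<integral>y. f y \<partial>D)\<bar> > (t + 2 * \<rho>) + t}
      \<le> 2 * measure (PiM {..<2*m} (\<lambda>_. D))
          {z \<in> {..<2*m} \<rightarrow>\<^sub>E X. \<exists>f\<in>F. m * (t + 2 * \<rho>) < \<bar>\<Sum>i<m. f (z i) - f (z (m + i))\<bar>}"
      by (rule measure_le_double_sample[OF X D F mpos _ small]) (use pos in simp)
    also have "\<dots> \<le> 2 * (N * (2 * exp (- (m * t\<^sup>2 / 2))))"
    proof (intro mult_left_mono measure_double_sample_le[OF X D])
      fix z assume "z \<in> {..<2*m} \<rightarrow>\<^sub>E X"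
      then have z: "z i \<in> X" if "i \<in> {..<2*m}" for i using that by (auto simp: PiE_def)
      have fd: "fat X F \<gamma> \<le> enat d" using d by (simp add: \<gamma>_def)
      have ne: "{..<2*m} \<noteq> {}" using mpos by (simp add: lessThan_empty_iff)
      from exists_net_of_fat[OF F fd finite_lessThan ne z pos(2,1) k(1,2) \<rho> gap v]
      show "\<exists>G. finite G \<and> card G \<le> N \<and> (\<forall>g\<in>G. \<forall>j<2*m. g j \<in> {0..1::real}) \<and>
        (\<forall>f\<in>F. \<exists>g\<in>G. (\<Sum>j<2*m. \<bar>f (z j) - g j\<bar>) \<le> \<rho> * (2 * m))"
        unfolding N_def by (simp add: Ball_def)
    qed (use pos in auto)
    also have "\<dots> = 4 * N * exp (- (e / 2))" by (simp add: t_def e_def)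
    also have "\<dots> = exp (ln 4) * exp (ln N) * exp (- (e / 2))" using Npos by simp
    also have "\<dots> = exp (ln 4 + ln N - e / 2)"
      by (simp only: exp_add[symmetric] diff_conv_add_uminus)
    \<comment> \<open>The net costs at most \<open>e / 8 + e / 4 - 3 * l\<close>, which
      \<open>e / 2\<close> outweighs; of the remaining \<open>- 3 * l\<close>, two parts pay for
      \<open>ln 4\<close>.\<close>
    also have "\<dots> \<le> exp (- l)"
    proof -
      have "ln 4 = 2 * ln (2::real)" using ln_realpow[of 2 2] by simp
      moreover have "3 * l \<le> c * l" using c l by (intro mult_right_mono) auto
      moreover have "e \<ge> 0" using e3 l by linarith
      ultimately have "ln 4 + ln N - e / 2 \<le> - l" using lnN e l by linarith
      then show ?thesis by simp
    qed
    also have "exp (- l) = \<delta>" using \<delta> by (simp add: l_def ln_div)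
    also have "(t + 2 * \<rho>) + t = \<epsilon>" by (simp add: t_def \<rho>_def algebra_simps)
    finally show "measure (PiM {..<m} (\<lambda>_. D)) {x \<in> space (PiM {..<m} (\<lambda>_. D)).
        \<exists>f\<in>F. \<bar>(1 / m) * (\<Sum>i<m. f (x i)) - (\<integral>y. f y \<partial>D)\<bar> > \<epsilon>} \<le> \<delta>" .
  qed
  then show ?thesis using that C1 by blast
qed

section \<open>Change of domain\<close>

text \<open>Rounding \<open>x\<close> up to an integer gives at most \<open>x + 1\<close>, hence at
  most \<open>2 * x\<close>.\<close>

lemma m_GC_le:
  assumes x: "x \<ge> 1" and ok: "\<And>m. x \<le> real m \<Longrightarrow> GC_ok X F \<epsilon> \<delta> m"
  shows "ereal_of_enat (m_GC X F \<epsilon> \<delta>) \<le> ereal (2 * x)"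
proof -
  define n where "n = nat \<lceil>x\<rceil>"
  have n: "x \<le> real n" "real n \<le> x + 1" using x by (auto simp: n_def)
  then have "1 \<le> n" using x by linarith
  moreover have "GC_ok X F \<epsilon> \<delta> m" if "m \<ge> n" for m
    using n that by (intro ok) linarith
  ultimately have "m_GC X F \<epsilon> \<delta> \<le> enat n"
    unfolding m_GC_def by (intro Inf_lower) blast
  then have "ereal_of_enat (m_GC X F \<epsilon> \<delta>) \<le> ereal_of_enat (enat n)"
    by (simp only: ereal_of_enat_le_iff)
  also have "\<dots> \<le> ereal (2 * x)" using n x by simp
  finally show ?thesis .
qed

lemma fatly_shatters_map:
  assumes "fatly_shatters F \<gamma> ps" and "\<And>f. f \<in> F \<Longrightarrow> \<exists>f'\<in>F'. \<forall>x\<in>X. f' (h x) = f x"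
    and "set ps \<subseteq> X \<times> R"
  shows "fatly_shatters F' \<gamma> (map (\<lambda>p. (h (fst p), snd p)) ps)"
  unfolding fatly_shatters_def
proof (intro allI impI)
  fix b :: "bool list" assume "length b = length (map (\<lambda>p. (h (fst p), snd p)) ps)"
  then have "length b = length ps" by simp
  then obtain f where f: "f \<in> F" "\<And>j. j < length ps \<Longrightarrow>
      (b ! j \<longrightarrow> snd (ps ! j) + \<gamma> \<le> f (fst (ps ! j))) \<and> (\<not> b ! j \<longrightarrow> f (fst (ps ! j)) \<le> snd (ps ! j) - \<gamma>)"
    using assms(1) unfolding fatly_shatters_def by metis
  obtain f' where f': "f' \<in> F'" "\<And>x. x \<in> X \<Longrightarrow> f' (h x) = f x" using assms(2)[OF f(1)] by metis
  show "\<exists>f\<in>F'. \<forall>j<length (map (\<lambda>p. (h (fst p), snd p)) ps).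
      (b ! j \<longrightarrow> snd (map (\<lambda>p. (h (fst p), snd p)) ps ! j) + \<gamma> \<le> f (fst (map (\<lambda>p. (h (fst p), snd p)) ps ! j))) \<and>
      (\<not> b ! j \<longrightarrow> f (fst (map (\<lambda>p. (h (fst p), snd p)) ps ! j)) \<le> snd (map (\<lambda>p. (h (fst p), snd p)) ps ! j) - \<gamma>)"
  proof (intro bexI[OF _ f'(1)] allI impI)
    fix j assume "j < length (map (\<lambda>p. (h (fst p), snd p)) ps)"
    then have j: "j < length ps" by simp
    then have "ps ! j \<in> X \<times> R" using assms(3) nth_mem by blast
    then have "f' (h (fst (ps ! j))) = f (fst (ps ! j))" by (intro f'(2)) (simp add: mem_Times_iff)
    then show "(b ! j \<longrightarrow> snd (map (\<lambda>p. (h (fst p), snd p)) ps ! j) + \<gamma> \<le> f' (fst (map (\<lambda>p. (h (fst p), snd p)) ps ! j))) \<and>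
      (\<not> b ! j \<longrightarrow> f' (fst (map (\<lambda>p. (h (fst p), snd p)) ps ! j)) \<le> snd (map (\<lambda>p. (h (fst p), snd p)) ps ! j) - \<gamma>)"
      using f(2)[OF j] j by simp
  qed
qed

lemma
  assumes "\<And>f. f \<in> F \<Longrightarrow> \<exists>f'\<in>F'. \<forall>x\<in>X. f' (h x) = f x" and h: "h \<in> X \<rightarrow> Y"
  shows fat_le_map: "fat X F \<gamma> \<le> fat Y F' \<gamma>" and fatV_le_map: "fatV X F \<gamma> \<le> fatV Y F' \<gamma>"
proof -
  let ?m = "map (\<lambda>p. (h (fst p), snd p))"
  have m: "set (?m ps) \<subseteq> Y \<times> {0..1}" "fatly_shatters F' \<gamma> (?m ps)"
    if ps: "set ps \<subseteq> X \<times> {0..1}" "fatly_shatters F \<gamma> ps" for ps :: "('a \<times> real) list"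
    using fatly_shatters_map[OF ps(2) assms(1) ps(1)] ps(1) h by (auto simp: Pi_def subset_iff)
  show "fat X F \<gamma> \<le> fat Y F' \<gamma>"
    unfolding fat_def
  proof (rule Sup_least)
    fix n assume "n \<in> {enat (length ps) |ps. set ps \<subseteq> X \<times> {0..1} \<and> fatly_shatters F \<gamma> ps}"
    then obtain ps where n: "n = enat (length (?m ps))"
      and ps: "set ps \<subseteq> X \<times> {0..1}" "fatly_shatters F \<gamma> ps" by auto
    show "n \<le> Sup {enat (length ps) |ps. set ps \<subseteq> Y \<times> {0..1} \<and> fatly_shatters F' \<gamma> ps}"
      unfolding n using m[OF ps] by (intro Sup_upper CollectI exI[of _ "?m ps"] conjI refl)
  qed
  show "fatV X F \<gamma> \<le> fatV Y F' \<gamma>"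
    unfolding fatV_def
  proof (rule Sup_least)
    fix n assume "n \<in> {enat (length ps) |ps. set ps \<subseteq> X \<times> {0..1} \<and>
      (\<exists>r\<in>{0..1}. \<forall>p\<in>set ps. snd p = r) \<and> fatly_shatters F \<gamma> ps}"
    then obtain ps r where n: "n = enat (length (?m ps))"
      and ps: "set ps \<subseteq> X \<times> {0..1}" "fatly_shatters F \<gamma> ps" and r: "r \<in> {0..1}" "\<forall>p\<in>set ps. snd p = r"
      by auto
    have "\<forall>p\<in>set (?m ps). snd p = r" using r(2) by simp
    then show "n \<le> Sup {enat (length ps) |ps. set ps \<subseteq> Y \<times> {0..1} \<and>
        (\<exists>r\<in>{0..1}. \<forall>p\<in>set ps. snd p = r) \<and> fatly_shatters F' \<gamma> ps}"
      unfolding n using m[OF ps] r(1)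
      by (intro Sup_upper CollectI exI[of _ "?m ps"] conjI refl bexI[of _ r])
  qed
qed

text \<open>Push \<open>D\<close> forward along \<open>h\<close>. Integrals agree by change of
  variables, so the deviation event for \<open>F\<close> is the preimage of the one for
  \<open>F'\<close> under coordinatewise \<open>h\<close>, and the product measures correspond as
  well.\<close>

lemma GC_ok_of_image:
  fixes F :: "('a \<Rightarrow> real) set" and F' :: "('b \<Rightarrow> real) set"
  assumes X: "countable X" and ok: "GC_ok (h ` X) F' \<epsilon> \<delta> m"
    and F: "\<And>f. f \<in> F \<Longrightarrow> \<exists>f'\<in>F'. \<forall>x\<in>X. f' (h x) = f x"
      "\<And>f'. f' \<in> F' \<Longrightarrow> \<exists>f\<in>F. \<forall>x\<in>X. f' (h x) = f x"
  shows "GC_ok X F \<epsilon> \<delta> m"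
  unfolding GC_ok_def
proof (intro allI impI, elim conjE)
  fix D assume D: "prob_space D" "sets D = Pow X"
  interpret D: prob_space D by fact
  have sp: "space D = X" by (rule space_eq_of_sets_Pow[OF D(2)])
  define D' where "D' = distr D (count_space (h ` X)) h"
  have h: "h \<in> measurable D (count_space (h ` X))" by (auto simp: measurable_def D(2) sp)
  have D': "prob_space D'" "sets D' = Pow (h ` X)" "space D' = h ` X"
    unfolding D'_def by (auto intro: D.prob_space_distr h)
  have hD': "h \<in> measurable D D'" using h by (simp add: D'_def)
  have D'_eq: "distr D D' h = D'" unfolding D'_def by (rule distr_cong) auto
  let ?I = "{..<m}"
  let ?P = "PiM ?I (\<lambda>_. D)" and ?P' = "PiM ?I (\<lambda>_. D')"
  let ?E = "{x \<in> space ?P. \<exists>f\<in>F. \<bar>(1 / m) * (\<Sum>i<m. f (x i)) - (\<integral>y. f y \<partial>D)\<bar> > \<epsilon>}"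
  let ?E' = "{x \<in> space ?P'. \<exists>f\<in>F'. \<bar>(1 / m) * (\<Sum>i<m. f (x i)) - (\<integral>y. f y \<partial>D')\<bar> > \<epsilon>}"
  have P': "distr ?P ?P' (compose ?I h) = ?P'"
    using distr_PiM_finite_prob_space'[of ?I "\<lambda>_. D" "\<lambda>_. D'" h] D(1) D'(1) hD' D'_eq by simp
  have cm: "compose ?I h \<in> measurable ?P ?P'"
    unfolding compose_def using hD' by (intro measurable_restrict measurable_compose[OF measurable_component_singleton])
  have int: "(\<integral>y. f' y \<partial>D') = (\<integral>y. f y \<partial>D)" if "f' \<in> F'" "\<forall>x\<in>X. f' (h x) = f x" for f f'
  proof -
    have "(\<integral>y. f' y \<partial>D') = (\<integral>x. f' (h x) \<partial>D)"
      unfolding D'_def by (rule integral_distr[OF h]) (auto simp: measurable_def)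
    also have "\<dots> = (\<integral>y. f y \<partial>D)" by (rule Bochner_Integration.integral_cong) (use that sp in auto)
    finally show ?thesis .
  qed
  have "sets ?P' = Pow (PiE ?I (\<lambda>_. h ` X))"
    by (rule sets_PiM_eq_Pow) (use X D' in auto)
  then have E': "?E' \<in> sets ?P'" by (auto simp: space_PiM D')
  have eq: "compose ?I h -` ?E' \<inter> space ?P = ?E"
  proof (intro set_eqI iffI)
    fix x assume "x \<in> compose ?I h -` ?E' \<inter> space ?P"
    then obtain f' where x: "x \<in> space ?P" and f': "f' \<in> F'"
      "\<bar>(1 / m) * (\<Sum>i<m. f' (compose ?I h x i)) - (\<integral>y. f' y \<partial>D')\<bar> > \<epsilon>" by auto
    obtain f where f: "f \<in> F" "\<forall>x\<in>X. f' (h x) = f x" using F(2)[OF f'(1)] by blast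
    have "(\<Sum>i<m. f' (compose ?I h x i)) = (\<Sum>i<m. f (x i))"
      by (rule sum.cong) (use x f sp in \<open>auto simp: compose_def space_PiM PiE_def Pi_def\<close>)
    then have "\<bar>(1 / m) * (\<Sum>i<m. f (x i)) - (\<integral>y. f y \<partial>D)\<bar> > \<epsilon>"
      using f'(2) int[OF f'(1) f(2)] by simp
    then show "x \<in> ?E" using x f(1) by blast
  next
    fix x assume "x \<in> ?E"
    then obtain f where x: "x \<in> space ?P" and f: "f \<in> F"
      "\<bar>(1 / m) * (\<Sum>i<m. f (x i)) - (\<integral>y. f y \<partial>D)\<bar> > \<epsilon>" by auto
    obtain f' where f': "f' \<in> F'" "\<forall>x\<in>X. f' (h x) = f x" using F(1)[OF f(1)] by blast
    have "(\<Sum>i<m. f' (compose ?I h x i)) = (\<Sum>i<m. f (x i))"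
      by (rule sum.cong) (use x f' sp in \<open>auto simp: compose_def space_PiM PiE_def Pi_def\<close>)
    then have "\<bar>(1 / m) * (\<Sum>i<m. f' (compose ?I h x i)) - (\<integral>y. f' y \<partial>D')\<bar> > \<epsilon>"
      using f(2) int[OF f'] by simp
    then show "x \<in> compose ?I h -` ?E' \<inter> space ?P"
      using measurable_space[OF cm x] x f'(1) by blast
  qed
  have "measure ?P ?E = measure (distr ?P ?P' (compose ?I h)) ?E'"
    unfolding eq[symmetric] by (rule measure_distr[OF cm E', symmetric])
  also have "\<dots> = measure ?P' ?E'" by (simp only: P')
  also have "\<dots> \<le> \<delta>" using ok D'(1,2) unfolding GC_ok_def by blast
  finally show "measure ?P ?E \<le> \<delta>" .
qed

text \<open>An injection \<open>h\<close> moves \<open>X\<close> into \<open>'b\<close>, and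
  \<open>F'\<close> consists of the functions of \<open>F\<close> read through its inverse.
  Comparing along \<open>h\<close> and along its inverse shows that the dimensions coincide, so the
  right-hand sides of the bounds are unchanged.\<close>

lemma valid_const_transfer:
  assumes C: "valid_const TYPE('b) \<kappa> C" and ex: "\<And>X :: 'a set. countable X \<Longrightarrow> \<exists>h :: 'a \<Rightarrow> 'b. inj_on h X"
  shows "valid_const TYPE('a) \<kappa> C"
  unfolding valid_const_def
proof (intro allI impI, elim conjE)
  fix X :: "'a set" and F assume X: "countable X" and F: "F \<subseteq> X \<rightarrow> {0..1::real}"
  obtain h :: "'a \<Rightarrow> 'b" where h: "inj_on h X" using ex[OF X] by blast
  define g where "g = the_inv_into X h"
  define F' where "F' = (\<lambda>f y. f (g y)) ` F"
  have gh: "g (h x) = x" if "x \<in> X" for x unfolding g_def by (rule the_inv_into_f_f[OF h that])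
  have FF': "\<exists>f'\<in>F'. \<forall>x\<in>X. f' (h x) = f x" if "f \<in> F" for f
    using that gh by (auto simp: F'_def)
  have F'F: "\<exists>f\<in>F. \<forall>x\<in>X. f' (h x) = f x" if "f' \<in> F'" for f'
    using that gh by (auto simp: F'_def)
  have F'F': "\<exists>f\<in>F. \<forall>y\<in>h ` X. f (g y) = f' y" if "f' \<in> F'" for f'
    using that by (auto simp: F'_def)
  have "countable (h ` X)" "F' \<subseteq> h ` X \<rightarrow> {0..1}"
    using X F gh by (auto simp: F'_def Pi_def subset_iff)
  then have b: "fat_bound \<kappa> C (h ` X) F'" "fatV_bound \<kappa> C (h ` X) F'"
    using C unfolding valid_const_def by blast+
  have gX: "g \<in> h ` X \<rightarrow> X" and hX: "h \<in> X \<rightarrow> h ` X" using gh by auto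
  have fat: "fat (h ` X) F' \<gamma> = fat X F \<gamma>" "fatV (h ` X) F' \<gamma> = fatV X F \<gamma>" for \<gamma>
    using fat_le_map[OF FF' hX] fatV_le_map[OF FF' hX] fat_le_map[OF F'F' gX] fatV_le_map[OF F'F' gX]
    by (simp_all add: antisym)
  have "m_GC X F \<epsilon> \<delta> \<le> m_GC (h ` X) F' \<epsilon> \<delta>" for \<epsilon> \<delta>
    \<comment> \<open>A sample size that works for the image works for \<open>X\<close>, so the
      infimum for \<open>X\<close> is over a larger set.\<close>
    unfolding m_GC_def using GC_ok_of_image[OF X _ FF' F'F] by (intro Inf_superset_mono) blast
  then have m: "ereal_of_enat (m_GC X F \<epsilon> \<delta>) \<le> ereal_of_enat (m_GC (h ` X) F' \<epsilon> \<delta>)" for \<epsilon> \<delta>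
    by (simp only: ereal_of_enat_le_iff)
  show "fat_bound \<kappa> C X F \<and> fatV_bound \<kappa> C X F"
    using b order_trans[OF m] unfolding fat_bound_def fatV_bound_def fat by blast
qed

section \<open>The two bounds and their constants\<close>

text \<open>Supplies the condition \<open>x >= 1\<close> of \<open>m_GC_le\<close>: the first factor
  is at least 4 and \<open>ln 2\<close> is at least \<open>1 / 4\<close>.\<close>

lemma sample_size_ge_1:
  fixes B \<epsilon> a l :: real
  assumes "B \<ge> 1" "0 < \<epsilon>" "\<epsilon> \<le> 1 / 2" "a \<ge> 0" "ln 2 \<le> l"
  shows "1 \<le> B / \<epsilon>\<^sup>2 * (a + l)"
proof -
  have "\<epsilon>\<^sup>2 \<le> (1 / 2)\<^sup>2" using assms by (intro power_mono) auto
  then have "4 * \<epsilon>\<^sup>2 \<le> B" using assms(1) by (simp add: power2_eq_square)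
  then have "4 \<le> B / \<epsilon>\<^sup>2" using assms by (simp add: pos_le_divide_eq)
  moreover have "1 / 4 \<le> a + l"
  proof -
    have "exp (1 / 4) \<le> (2::real)" using exp_bound[of "1 / 4 :: real"] by (simp add: power2_eq_square)
    then have "1 / 4 \<le> ln (2::real)" by (subst ln_ge_iff) auto
    then show ?thesis using assms by linarith
  qed
  ultimately have "4 * (1 / 4) \<le> B / \<epsilon>\<^sup>2 * (a + l)" by (intro mult_mono) auto
  then show ?thesis by simp
qed

text \<open>The sample bound carries a single logarithm, and \<open>L >= ln 2\<close> replaces it by
  \<open>L^2 / ln 2\<close>. Every larger constant is included so that this bound can share a
  constant with the one for \<open>fatV\<close>.\<close>

lemma exists_fat_bound:
  assumes \<kappa>: "0 < \<kappa>" "\<kappa> < 1 / 4"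
  shows "\<exists>C. \<forall>C'\<ge>C. \<forall>(X :: 'a set) F. countable X \<longrightarrow> F \<subseteq> X \<rightarrow> {0..1} \<longrightarrow> fat_bound \<kappa> C' X F"
proof -
  obtain B where B: "B \<ge> 1" "\<And>(X :: 'a set) F \<epsilon> \<delta> d m. countable X \<Longrightarrow> F \<subseteq> X \<rightarrow> {0..1} \<Longrightarrow>
      0 < \<epsilon> \<Longrightarrow> \<epsilon> \<le> 1 / 2 \<Longrightarrow> 0 < \<delta> \<Longrightarrow> \<delta> \<le> 1 / 2 \<Longrightarrow> fat X F ((1 / 4 - \<kappa>) * \<epsilon>) \<le> enat d \<Longrightarrow>
      B / \<epsilon>\<^sup>2 * (d * ln (1 / \<epsilon>) + ln (1 / \<delta>)) \<le> real m \<Longrightarrow> GC_ok X F \<epsilon> \<delta> m"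
    using GC_ok_of_sample_size[OF \<kappa>] by metis
  have "fat_bound \<kappa> C X F" if C: "C \<ge> 2 * B / ln 2" and X: "countable X" "F \<subseteq> X \<rightarrow> {0..1}"
    for C and X :: "'a set" and F
    unfolding fat_bound_def
  proof (intro allI impI, elim conjE)
    fix \<epsilon> \<delta> :: real
    assume fin: "\<forall>\<epsilon>>0. fat X F ((1 / 4 - \<kappa>) * \<epsilon>) < \<infinity>" and \<epsilon>: "0 < \<epsilon>" "\<epsilon> \<le> 1 / 2" and \<delta>: "0 < \<delta>" "\<delta> \<le> 1 / 2"
    then obtain d where d: "fat X F ((1 / 4 - \<kappa>) * \<epsilon>) = enat d" by fastforce
    define L where "L = ln (1 / \<epsilon>)"
    define l where "l = ln (1 / \<delta>)"
    have L: "ln 2 \<le> L" unfolding L_def using \<epsilon> by (subst ln_le_cancel_iff) (auto simp: field_simps)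
    have l: "ln 2 \<le> l" unfolding l_def using \<delta> by (subst ln_le_cancel_iff) (auto simp: field_simps)
    have ln2: "0 < ln (2::real)" "ln (2::real) \<le> 1" using ln_le_minus_one[of 2] by auto
    have L0: "0 \<le> L" "0 \<le> l" using L l ln2 by linarith+
    define x where "x = B / \<epsilon>\<^sup>2 * (d * L + l)"
    have "0 \<le> d * L" using L0 by simp
    then have x1: "x \<ge> 1" unfolding x_def by (intro sample_size_ge_1 B(1) \<epsilon> l)
    have "ereal_of_enat (m_GC X F \<epsilon> \<delta>) \<le> ereal (2 * x)"
    proof (rule m_GC_le[OF x1])
      show "GC_ok X F \<epsilon> \<delta> m" if "x \<le> real m" for m
        using B(2)[OF X \<epsilon> \<delta>, of d m] d that by (simp add: x_def L_def l_def)
    qed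
    also have "2 * x \<le> C / \<epsilon>\<^sup>2 * (d * L\<^sup>2 + l)"
    proof -
      have "d * L * ln 2 \<le> d * L * L" using L L0 by (intro mult_left_mono) auto
      moreover have "l * ln 2 \<le> l" using L0 ln2 by (intro mult_left_le)
      ultimately have "(d * L + l) * ln 2 \<le> d * L\<^sup>2 + l" by (simp add: algebra_simps power2_eq_square)
      then have "2 * B / ln 2 * ((d * L + l) * ln 2) \<le> 2 * B / ln 2 * (d * L\<^sup>2 + l)"
        using B(1) ln2 by (intro mult_left_mono) auto
      also have "\<dots> \<le> C * (d * L\<^sup>2 + l)" using C L0 by (intro mult_right_mono) auto
      finally have "2 * B * (d * L + l) \<le> C * (d * L\<^sup>2 + l)" using ln2 by simp
      then have "2 * B * (d * L + l) / \<epsilon>\<^sup>2 \<le> C * (d * L\<^sup>2 + l) / \<epsilon>\<^sup>2" by (rule divide_right_mono) simp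
      then show ?thesis by (simp add: x_def)
    qed
    finally show "ereal_of_enat (m_GC X F \<epsilon> \<delta>) \<le> ereal (C / \<epsilon>\<^sup>2) *
        (ereal_of_enat (fat X F ((1 / 4 - \<kappa>) * \<epsilon>)) * ereal ((ln (1 / \<epsilon>))\<^sup>2) + ereal (ln (1 / \<delta>)))"
      by (simp add: d L_def l_def)
  qed
  then show ?thesis by blast
qed

text \<open>The sample bound is used with \<open>\<kappa> / 2\<close>. The difference between the
  scales for \<open>\<kappa> / 2\<close> and \<open>\<kappa>\<close> is
  \<open>\<kappa> * \<epsilon> / 2\<close>, the grid width for rounding thresholds. That grid has at
  most \<open>4 / (\<kappa> * \<epsilon>)\<close> points, which is the source of the factor
  \<open>1 / \<epsilon>\<close>.\<close>

lemma exists_fatV_bound: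
  assumes \<kappa>: "0 < \<kappa>" "\<kappa> < 1 / 4"
  shows "\<exists>C. \<forall>C'\<ge>C. \<forall>(X :: 'a set) F. countable X \<longrightarrow> F \<subseteq> X \<rightarrow> {0..1} \<longrightarrow> fatV_bound \<kappa> C' X F"
proof -
  have "0 < \<kappa> / 2" "\<kappa> / 2 < 1 / 4" using \<kappa> by auto
  then obtain B where B: "B \<ge> 1" "\<And>(X :: 'a set) F \<epsilon> \<delta> d m. countable X \<Longrightarrow> F \<subseteq> X \<rightarrow> {0..1} \<Longrightarrow>
      0 < \<epsilon> \<Longrightarrow> \<epsilon> \<le> 1 / 2 \<Longrightarrow> 0 < \<delta> \<Longrightarrow> \<delta> \<le> 1 / 2 \<Longrightarrow> fat X F ((1 / 4 - \<kappa> / 2) * \<epsilon>) \<le> enat d \<Longrightarrow>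
      B / \<epsilon>\<^sup>2 * (d * ln (1 / \<epsilon>) + ln (1 / \<delta>)) \<le> real m \<Longrightarrow> GC_ok X F \<epsilon> \<delta> m"
    using GC_ok_of_sample_size[of "\<kappa> / 2"] by metis
  \<comment> \<open>In \<open>8 * B / \<kappa>\<close>, a factor 2 comes from \<open>m_GC_le\<close>
    and \<open>4 / \<kappa>\<close> from the size of the grid.\<close>
  have "fatV_bound \<kappa> C X F" if C: "C \<ge> 8 * B / \<kappa>" and X: "countable X" "F \<subseteq> X \<rightarrow> {0..1}"
    for C and X :: "'a set" and F
    unfolding fatV_bound_def
  proof (intro allI impI, elim conjE)
    fix \<epsilon> \<delta> :: real
    assume fin: "\<forall>\<epsilon>>0. fatV X F ((1 / 4 - \<kappa>) * \<epsilon>) < \<infinity>" and \<epsilon>: "0 < \<epsilon>" "\<epsilon> \<le> 1 / 2" and \<delta>: "0 < \<delta>" "\<delta> \<le> 1 / 2"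
    then obtain dv where dv: "fatV X F ((1 / 4 - \<kappa>) * \<epsilon>) = enat dv" by fastforce
    define L where "L = ln (1 / \<epsilon>)"
    define l where "l = ln (1 / \<delta>)"
    have L: "ln 2 \<le> L" unfolding L_def using \<epsilon> by (subst ln_le_cancel_iff) (auto simp: field_simps)
    have l: "ln 2 \<le> l" unfolding l_def using \<delta> by (subst ln_le_cancel_iff) (auto simp: field_simps)
    have "0 < ln (2::real)" by simp
    then have L0: "0 \<le> L" "0 \<le> l" using L l by linarith+
    define \<eta> where "\<eta> = \<kappa> * \<epsilon> / 2"
    define d where "d = card (grid \<eta>) * dv"
    have \<eta>: "\<eta> > 0" using \<kappa> \<epsilon> by (simp add: \<eta>_def)
    have "fat X F ((1 / 4 - \<kappa>) * \<epsilon> + \<eta>) \<le> enat d"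
      unfolding d_def by (rule fat_le_fatV) (use \<kappa> \<epsilon> \<eta> dv in auto)
    moreover have "(1 / 4 - \<kappa>) * \<epsilon> + \<eta> = (1 / 4 - \<kappa> / 2) * \<epsilon>" by (simp add: \<eta>_def algebra_simps)
    ultimately have fd: "fat X F ((1 / 4 - \<kappa> / 2) * \<epsilon>) \<le> enat d" by simp
    have "\<eta> \<le> 1" using mult_mono[of \<kappa> 1 \<epsilon> 1] \<kappa> \<epsilon> by (simp add: \<eta>_def)
    then have "1 / \<eta> + 1 \<le> 2 / \<eta>" using \<eta> by (simp add: field_simps)
    then have "card (grid \<eta>) \<le> 4 / \<kappa> * (1 / \<epsilon>)"
      using card_grid_le[OF \<eta>] \<kappa> \<epsilon> by (simp add: \<eta>_def)
    then have "real (card (grid \<eta>)) * dv \<le> 4 / \<kappa> * (1 / \<epsilon>) * dv" by (rule mult_right_mono) simp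
    then have d: "d \<le> 4 / \<kappa> * (1 / \<epsilon> * dv)" by (simp add: d_def)
    define x where "x = B / \<epsilon>\<^sup>2 * (d * L + l)"
    have "0 \<le> d * L" using L0 by simp
    then have x1: "x \<ge> 1" unfolding x_def by (intro sample_size_ge_1 B(1) \<epsilon> l)
    have "ereal_of_enat (m_GC X F \<epsilon> \<delta>) \<le> ereal (2 * x)"
    proof (rule m_GC_le[OF x1])
      show "GC_ok X F \<epsilon> \<delta> m" if "x \<le> real m" for m
        using B(2)[OF X \<epsilon> \<delta> fd, of m] that by (simp add: x_def L_def l_def)
    qed
    also have "2 * x \<le> C / \<epsilon>\<^sup>2 * (1 / \<epsilon> * dv * L + l)"
    proof -
      have "d * L \<le> 4 / \<kappa> * (1 / \<epsilon> * dv) * L" using d L0 by (intro mult_right_mono) auto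
      moreover have "1 * l \<le> 4 / \<kappa> * l" using \<kappa> L0 by (intro mult_right_mono) auto
      ultimately have "d * L + l \<le> 4 / \<kappa> * (1 / \<epsilon> * dv * L + l)" by (simp add: algebra_simps)
      then have "2 * B * (d * L + l) \<le> 2 * B * (4 / \<kappa> * (1 / \<epsilon> * dv * L + l))"
        using B(1) by (intro mult_left_mono) auto
      also have "\<dots> = 8 * B / \<kappa> * (1 / \<epsilon> * dv * L + l)" by simp
      also have "\<dots> \<le> C * (1 / \<epsilon> * dv * L + l)" using C L0 \<epsilon> by (intro mult_right_mono) auto
      finally have "2 * B * (d * L + l) / \<epsilon>\<^sup>2 \<le> C * (1 / \<epsilon> * dv * L + l) / \<epsilon>\<^sup>2"
        by (rule divide_right_mono) simp
      then show ?thesis by (simp add: x_def)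
    qed
    finally show "ereal_of_enat (m_GC X F \<epsilon> \<delta>) \<le> ereal (C / \<epsilon>\<^sup>2) *
        (ereal (1 / \<epsilon>) * ereal_of_enat (fatV X F ((1 / 4 - \<kappa>) * \<epsilon>)) * ereal (ln (1 / \<epsilon>)) + ereal (ln (1 / \<delta>)))"
      by (simp add: dv L_def l_def)
  qed
  then show ?thesis by blast
qed

theorem theorem12:
  fixes \<kappa> :: real
  assumes "0 < \<kappa>" and "\<kappa> < 1/4"
  shows "(\<exists>C. valid_const TYPE(nat) \<kappa> C) \<and>
         (\<forall>C. valid_const TYPE(nat) \<kappa> C \<longrightarrow> valid_const TYPE('a) \<kappa> C)"
proof (intro conjI allI impI)
  obtain C1 where C1: "\<forall>C'\<ge>C1. \<forall>(X :: nat set) F. countable X \<longrightarrow> F \<subseteq> X \<rightarrow> {0..1} \<longrightarrow> fat_bound \<kappa> C' X F"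
    using exists_fat_bound[OF assms] ..
  obtain C2 where C2: "\<forall>C'\<ge>C2. \<forall>(X :: nat set) F. countable X \<longrightarrow> F \<subseteq> X \<rightarrow> {0..1} \<longrightarrow> fatV_bound \<kappa> C' X F"
    using exists_fatV_bound[OF assms] ..
  have "valid_const TYPE(nat) \<kappa> (max C1 C2)"
    unfolding valid_const_def
    using C1[rule_format, of "max C1 C2"] C2[rule_format, of "max C1 C2"] by simp
  then show "\<exists>C. valid_const TYPE(nat) \<kappa> C" ..
  show "valid_const TYPE('a) \<kappa> C" if "valid_const TYPE(nat) \<kappa> C" for C
    by (rule valid_const_transfer[OF that]) (use inj_on_to_nat_on in blast)
qed

end
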